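(* Let $K$ be the quotient field of a principal ideal domain $\mathcal{O}_K$, let $L/K$ be a finite Galois extension with Galois group $G=J\rtimes G'$ ($J$ normal in $G$), put $E=L^{G'}$ and $F=L^J$, and let $\mathcal{O}_L,\mathcal{O}_E,\mathcal{O}_F$ be the integral closures of $\mathcal{O}_K$ in $L,E,F$. Let $L/K$ be equipped with an induced Hopf Galois structure, with Hopf algebra $H=H_1\otimes_K\overline H$, where $H_1$ and $\overline H$ are the Hopf algebras of the corresponding Hopf Galois structures of $E/K$ and $F/K$. Assume that $E/K$ and $F/K$ are arithmetically disjoint. Then: 1. $\mathfrak{A}_{H_1\otimes_K F}=\mathfrak{A}_{H_1}\otimes_{\mathcal{O}_K}\mathcal{O}_F$. 2. If $\mathcal{O}_E$ is $\mathfrak{A}_{H_1}$-free, then $\mathcal{O}_L$ is $\mathfrak{A}_{H_1\otimes_K F}$-free.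
   Context: Arithmetically disjoint: $E/K$ and $F/K$ are arithmetically disjoint if $\mathcal{O}_{EF}=\mathcal{O}_E\otimes_{\mathcal{O}_K}\mathcal{O}_F$, i.e. $E,F$ are linearly disjoint over $K$ and the canonical map $\mathcal{O}_E\otimes_{\mathcal{O}_K}\mathcal{O}_F\to\mathcal{O}_{EF}$ is an isomorphism (here $EF=L$). Hopf Galois structure on $L/F$: $H_1\otimes_K F$ is an $F$-Hopf algebra giving a Hopf Galois structure on $L/F$, where its action on $L=E\otimes_K F$ is the $F$-linear extension of the action of $H_1$ on $E$: $(w\otimes f)\cdot(\alpha\otimes z)=(w\cdot\alpha)\otimes fz$. Associated orders: $\mathfrak{A}_{H_1}=\{h\in H_1\mid h\cdot x\in\mathcal{O}_E\text{ for all }x\in\mathcal{O}_E\}$ and $\mathfrak{A}_{H_1\otimes_K F}=\{h\in H_1\otimes_K F\mid h\cdot x\in\mathcal{O}_L\text{ for all }x\in\mathcal{O}_L\}$. The module $\mathfrak{A}_{H_1}\otimes_{\mathcal{O}_K}\mathcal{O}_F$ is regarded inside $H_1\otimes_K F$. Freeness of a ring of integers over an associated order means there is an element $\beta$ in it such that $a\mapsto a\cdot\beta$ is a bijection from the associated order onto the ring of integers. Induced Hopf Galois structures. Let $\lambda':G'\to\mathrm{Perm}(G')$ and $\lambda:G\to\mathrm{Perm}(G)$ be the left regular representations, and $\lambda_c:G\to\mathrm{Perm}(J)$, $\lambda_c(\sigma\tau)(\sigma')=\sigma\tau\sigma'\tau^{-1}$ for $\sigma,\sigma'\in J$, $\tau\in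 G'$. A subgroup of $\mathrm{Perm}(Y)$ is regular if it acts simply transitively on $Y$. Let $N_1\le\mathrm{Perm}(J)$ be regular and normalized by $\lambda_c(G)$, and $N_2\le\mathrm{Perm}(G')$ regular and normalized by $\lambda'(G')$. Then: - $H_1=L[N_1]^G$ ($G$ acting on $L$ by the Galois action and on $N_1$ by conjugation via $\lambda_c$) acts on $E$ by $(\sum_i c_in_i)\cdot x=\sum_i c_in_i^{-1}(1_J)(x)$, giving a Hopf Galois structure of $E/K$; - $\overline H=F[N_2]^{G/J}$ (with $G/J\cong G'$ acting on $F$ by the Galois action and on $N_2$ by conjugation via $\lambda'$) acts on $F$ by $(\sum_j d_jm_j)\cdot z=\sum_j d_jm_j^{-1}(1_{G'})(z)$, giving a Hopf Galois structure of $F/K$; - with $\iota(\varphi,\psi)(\sigma\tau)=\varphi(\sigma)\psi(\tau)$, the group $N=\iota(N_1\times N_2)\le\mathrm{Perm}(G)$ is regular and normalized by $\lambda(G)$. The induced Hopf Galois structure of $L/K$ has Hopf algebra $H=L[N]^G$ ($G$ acting on $N$ by conjugation via $\lambda$) with action $(\sum_k c_kn_k)\cdot x=\sum_k c_kn_k^{-1}(1_G)(x)$ on $L$. One has $H=H_1\otimes_K\overline H$ via $(\sum_i c_in_i)\otimes(\sum_j d_jm_j)\mapsto\sum_{i,j}c_id_j\,\iota(n_i,m_j)$. *)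

theory Defs
  imports "HOL-Algebra.Algebra" "HOL-Algebra.Algebraic_Closure_Type"
begin

text \<open>The top field of every extension is a whole type of sort \<open>field\<close>; its subrings and
  subfields are subsets of that type, and become records through the following abbreviations.\<close>

abbreviation top_ring :: "'a::field ring"
  where "top_ring \<equiv> ring_of_type_algebra"

abbreviation subring_of :: "'a::field set \<Rightarrow> 'a ring"
  where "subring_of R \<equiv> top_ring\<lparr>carrier := R\<rparr>"

text \<open>A subset as a module over any of its scalar rings, acting by multiplication.\<close>

definition mult_module :: "'a::field set \<Rightarrow> ('a, 'a) module"
  where "mult_module M =
    \<lparr>carrier = M, monoid.mult = (*), one = 1, ring.zero = 0, add = (+), Module.module.smult = (*)\<rparr>"


section \<open>Tensor products of modules\<close>

definition tensor_relators ::
  "'r ring \<Rightarrow> ('r, 'm) module \<Rightarrow> ('r, 'n) module \<Rightarrow> ('m \<times> 'n \<Rightarrow>\<^sub>0 int) set"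
  where "tensor_relators R M N =
     {frag_of (m \<oplus>\<^bsub>M\<^esub> m', n) - frag_of (m, n) - frag_of (m', n) | m m' n.
        m \<in> carrier M \<and> m' \<in> carrier M \<and> n \<in> carrier N}
   \<union> {frag_of (m, n \<oplus>\<^bsub>N\<^esub> n') - frag_of (m, n) - frag_of (m, n') | m n n'.
        m \<in> carrier M \<and> n \<in> carrier N \<and> n' \<in> carrier N}
   \<union> {frag_of (r \<odot>\<^bsub>M\<^esub> m, n) - frag_of (m, r \<odot>\<^bsub>N\<^esub> n) | r m n.
        r \<in> carrier R \<and> m \<in> carrier M \<and> n \<in> carrier N}"

definition tensor_kernel ::
  "'r ring \<Rightarrow> ('r, 'm) module \<Rightarrow> ('r, 'n) module \<Rightarrow> ('m \<times> 'n \<Rightarrow>\<^sub>0 int) set"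
  where "tensor_kernel R M N =
    generate (free_Abelian_group (carrier M \<times> carrier N)) (tensor_relators R M N)"

text \<open>The additive group of the tensor product, written as a (multiplicative) group record.\<close>

definition tensor_product ::
  "'r ring \<Rightarrow> ('r, 'm) module \<Rightarrow> ('r, 'n) module \<Rightarrow> ('m \<times> 'n \<Rightarrow>\<^sub>0 int) set monoid"
  where "tensor_product R M N =
    free_Abelian_group (carrier M \<times> carrier N) Mod tensor_kernel R M N"

definition pure_tensor ::
  "'r ring \<Rightarrow> ('r, 'm) module \<Rightarrow> ('r, 'n) module \<Rightarrow> 'm \<Rightarrow> 'n \<Rightarrow> ('m \<times> 'n \<Rightarrow>\<^sub>0 int) set"
  where "pure_tensor R M N m n =
    tensor_kernel R M N #>\<^bsub>free_Abelian_group (carrier M \<times> carrier N)\<^esub> frag_of (m, n)"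

text \<open>The additive map sending each pure tensor of \<open>m\<close> and \<open>n\<close> to \<open>f m n\<close>; meaningful only for
  biadditive balanced \<open>f\<close>.\<close>

definition tensor_lift ::
  "'r ring \<Rightarrow> ('r, 'm) module \<Rightarrow> ('r, 'n) module \<Rightarrow> 'c monoid \<Rightarrow> ('m \<Rightarrow> 'n \<Rightarrow> 'c)
     \<Rightarrow> ('m \<times> 'n \<Rightarrow>\<^sub>0 int) set \<Rightarrow> 'c"
  where "tensor_lift R M N A f =
    (THE h. h \<in> hom (tensor_product R M N) A
          \<and> h \<in> extensional (carrier (tensor_product R M N))
          \<and> (\<forall>m \<in> carrier M. \<forall>n \<in> carrier N. h (pure_tensor R M N m n) = f m n))"

abbreviation field_tensor ::
  "'a::field set \<Rightarrow> 'a set \<Rightarrow> 'a set \<Rightarrow> ('a \<times> 'a \<Rightarrow>\<^sub>0 int) set monoid"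
  where "field_tensor R M N \<equiv> tensor_product (subring_of R) (mult_module M) (mult_module N)"

definition mult_map :: "'a::field set \<Rightarrow> 'a set \<Rightarrow> 'a set \<Rightarrow> ('a \<times> 'a \<Rightarrow>\<^sub>0 int) set \<Rightarrow> 'a"
  where "mult_map R M N =
    tensor_lift (subring_of R) (mult_module M) (mult_module N) (add_monoid top_ring) (*)"


section \<open>Fields and rings of integers\<close>

definition quotient_field :: "'a::field set \<Rightarrow> 'a set"
  where "quotient_field R = {a / b | a b. a \<in> R \<and> b \<in> R \<and> b \<noteq> 0}"

definition integral_closure :: "'a::field set \<Rightarrow> 'a set \<Rightarrow> 'a set"
  where "integral_closure R M =
    {x \<in> M. \<exists>p :: 'a Polynomial.poly. range (Polynomial.coeff p) \<subseteq> R
              \<and> Polynomial.lead_coeff p = 1 \<and> Polynomial.poly p x = 0}"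

definition galois_group :: "'a::field set \<Rightarrow> ('a \<Rightarrow> 'a) monoid"
  where "galois_group K =
    \<lparr>carrier = {\<sigma> \<in> ring_iso top_ring top_ring. \<forall>k \<in> K. \<sigma> k = k}, monoid.mult = (\<circ>), one = id\<rparr>"

definition fixed_field :: "('a::field \<Rightarrow> 'a) set \<Rightarrow> 'a set"
  where "fixed_field S = {x. \<forall>\<sigma> \<in> S. \<sigma> x = x}"

definition finite_galois :: "'a::field set \<Rightarrow> bool"
  where "finite_galois K \<longleftrightarrow>
    subfield K top_ring \<and> ring.finite_dimension top_ring K UNIV \<and>
    fixed_field (carrier (galois_group K)) = K"

definition linearly_disjoint :: "'a::field set \<Rightarrow> 'a set \<Rightarrow> 'a set \<Rightarrow> bool"
  where "linearly_disjoint K E F \<longleftrightarrow> inj_on (mult_map K E F) (carrier (field_tensor K E F))"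

definition arithmetically_disjoint :: "'a::field set \<Rightarrow> 'a set \<Rightarrow> 'a set \<Rightarrow> 'a set \<Rightarrow> bool"
  where "arithmetically_disjoint R K E F \<longleftrightarrow>
    linearly_disjoint K E F \<and>
    bij_betw (mult_map R (integral_closure R E) (integral_closure R F))
      (carrier (field_tensor R (integral_closure R E) (integral_closure R F)))
      (integral_closure R (generate_field top_ring (E \<union> F)))"


section \<open>Hopf algebras from permutation groups\<close>

definition regular_perm_group :: "'y set \<Rightarrow> ('y \<Rightarrow> 'y) set \<Rightarrow> bool"
  where "regular_perm_group Y N \<longleftrightarrow>
    subgroup N (BijGroup Y) \<and> (\<forall>x \<in> Y. \<forall>y \<in> Y. \<exists>!n. n \<in> N \<and> n x = y)"

definition left_regular :: "('a \<Rightarrow> 'a) set \<Rightarrow> ('a \<Rightarrow> 'a) \<Rightarrow> ('a \<Rightarrow> 'a) \<Rightarrow> ('a \<Rightarrow> 'a)"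
  where "left_regular Y g = (\<lambda>x \<in> Y. g \<circ> x)"

definition lambda_c ::
  "('a \<Rightarrow> 'a) set \<Rightarrow> ('a \<Rightarrow> 'a) set \<Rightarrow> ('a \<Rightarrow> 'a) \<Rightarrow> ('a \<Rightarrow> 'a) \<Rightarrow> ('a \<Rightarrow> 'a)"
  where "lambda_c J G' g =
    (\<lambda>s \<in> J. THE r. \<exists>\<sigma> \<in> J. \<exists>\<tau> \<in> G'. g = \<sigma> \<circ> \<tau> \<and> r = \<sigma> \<circ> \<tau> \<circ> s \<circ> inv_into UNIV \<tau>)"

definition iota_perm ::
  "('a \<Rightarrow> 'a) set \<Rightarrow> ('a \<Rightarrow> 'a) set \<Rightarrow> ('a \<Rightarrow> 'a) set
     \<Rightarrow> (('a \<Rightarrow> 'a) \<Rightarrow> ('a \<Rightarrow> 'a)) \<Rightarrow> (('a \<Rightarrow> 'a) \<Rightarrow> ('a \<Rightarrow> 'a)) \<Rightarrow> (('a \<Rightarrow> 'a) \<Rightarrow> ('a \<Rightarrow> 'a))"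
  where "iota_perm G J G' \<phi> \<psi> =
    (\<lambda>g \<in> G. THE r. \<exists>\<sigma> \<in> J. \<exists>\<tau> \<in> G'. g = \<sigma> \<circ> \<tau> \<and> r = \<phi> \<sigma> \<circ> \<psi> \<tau>)"

text \<open>The group algebra over \<open>C\<close> of a subgroup \<open>N\<close> of \<open>P\<close>. The scalars of the module structure may
  be taken from any subring of \<open>C\<close>.\<close>

definition group_algebra ::
  "'a::field set \<Rightarrow> 'n monoid \<Rightarrow> 'n set \<Rightarrow> ('a, 'n \<Rightarrow>\<^sub>0 'a) module"
  where "group_algebra C P N =
    \<lparr>carrier = {c. Poly_Mapping.keys c \<subseteq> N \<and> range (Poly_Mapping.lookup c) \<subseteq> C},
     monoid.mult = (\<lambda>c d. \<Sum>n \<in> Poly_Mapping.keys c. \<Sum>m \<in> Poly_Mapping.keys d.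
               Poly_Mapping.single (n \<otimes>\<^bsub>P\<^esub> m) (Poly_Mapping.lookup c n * Poly_Mapping.lookup d m)),
     one = Poly_Mapping.single \<one>\<^bsub>P\<^esub> 1, ring.zero = 0, add = (+),
     Module.module.smult = (\<lambda>k c. Poly_Mapping.map ((*) k) c)\<rparr>"

text \<open>The semilinear action of \<open>g\<close> on the group algebra, by \<open>g\<close> on the coefficients and by
  conjugation with \<open>\<rho> g\<close> on the group.\<close>

definition galois_action ::
  "'n monoid \<Rightarrow> (('a::field \<Rightarrow> 'a) \<Rightarrow> 'n) \<Rightarrow> ('a \<Rightarrow> 'a) \<Rightarrow> ('n \<Rightarrow>\<^sub>0 'a) \<Rightarrow> ('n \<Rightarrow>\<^sub>0 'a)"
  where "galois_action P \<rho> g c =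
    (\<Sum>n \<in> Poly_Mapping.keys c.
       Poly_Mapping.single (\<rho> g \<otimes>\<^bsub>P\<^esub> n \<otimes>\<^bsub>P\<^esub> inv\<^bsub>P\<^esub> (\<rho> g)) (g (Poly_Mapping.lookup c n)))"

definition hopf_algebra ::
  "'a::field set \<Rightarrow> ('a \<Rightarrow> 'a) set \<Rightarrow> 'n monoid \<Rightarrow> (('a \<Rightarrow> 'a) \<Rightarrow> 'n) \<Rightarrow> 'n set
     \<Rightarrow> ('a, 'n \<Rightarrow>\<^sub>0 'a) module"
  where "hopf_algebra C \<Gamma> P \<rho> N =
    (group_algebra C P N)
      \<lparr>carrier := {c \<in> carrier (group_algebra C P N). \<forall>g \<in> \<Gamma>. galois_action P \<rho> g c = c}\<rparr>"

text \<open>The action on a field, where \<open>N\<close> permutes the set \<open>Y\<close> of automorphisms, which contains the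
  identity.\<close>

definition hopf_action ::
  "('a::field \<Rightarrow> 'a) set \<Rightarrow> ((('a \<Rightarrow> 'a) \<Rightarrow> ('a \<Rightarrow> 'a)) \<Rightarrow>\<^sub>0 'a) \<Rightarrow> 'a \<Rightarrow> 'a"
  where "hopf_action Y c x =
    (\<Sum>n \<in> Poly_Mapping.keys c. Poly_Mapping.lookup c n * ((inv\<^bsub>BijGroup Y\<^esub> n) id) x)"

definition induced_structure ::
  "'a::field set \<Rightarrow> ('a \<Rightarrow> 'a) set \<Rightarrow> ('a \<Rightarrow> 'a) set \<Rightarrow> (('a \<Rightarrow> 'a) \<Rightarrow> ('a \<Rightarrow> 'a)) set
     \<Rightarrow> (('a \<Rightarrow> 'a) \<Rightarrow> ('a \<Rightarrow> 'a)) set \<Rightarrow> (('a \<Rightarrow> 'a) \<Rightarrow> ('a \<Rightarrow> 'a)) set \<Rightarrow> bool"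
  where "induced_structure K J G' N1 N2 N \<longleftrightarrow>
    regular_perm_group J N1 \<and>
    lambda_c J G' ` carrier (galois_group K) \<subseteq> normalizer (BijGroup J) N1 \<and>
    regular_perm_group G' N2 \<and>
    left_regular G' ` G' \<subseteq> normalizer (BijGroup G') N2 \<and>
    N = {iota_perm (carrier (galois_group K)) J G' \<phi> \<psi> | \<phi> \<psi>. \<phi> \<in> N1 \<and> \<psi> \<in> N2}"

text \<open>The action of \<open>H \<otimes>\<^sub>K F\<close> on the top field, with \<open>x\<close> read in \<open>E \<otimes>\<^sub>K F\<close> through the
  multiplication map: \<open>(w \<otimes> f) \<cdot> (\<alpha> \<otimes> z) = (w \<cdot> \<alpha>) \<otimes> fz\<close>.\<close>

definition base_change_action ::
  "'a::field set \<Rightarrow> 'a set \<Rightarrow> 'a set \<Rightarrow> ('a, 'h) module \<Rightarrow> ('h \<Rightarrow> 'a \<Rightarrow> 'a)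
     \<Rightarrow> ('h \<times> 'a \<Rightarrow>\<^sub>0 int) set \<Rightarrow> 'a \<Rightarrow> 'a"
  where "base_change_action K E F H act t x =
    tensor_lift (subring_of K) H (mult_module F) (add_monoid top_ring)
      (\<lambda>w f. tensor_lift (subring_of K) (mult_module E) (mult_module F) (add_monoid top_ring)
                (\<lambda>\<alpha> z. act w \<alpha> * (f * z))
                (inv_into (carrier (field_tensor K E F)) (mult_map K E F) x))
      t"

definition associated_order :: "'h set \<Rightarrow> ('h \<Rightarrow> 'a \<Rightarrow> 'a) \<Rightarrow> 'a set \<Rightarrow> 'h set"
  where "associated_order H act R = {h \<in> H. \<forall>x \<in> R. act h x \<in> R}"

definition free_over_order :: "'h set \<Rightarrow> ('h \<Rightarrow> 'a \<Rightarrow> 'a) \<Rightarrow> 'a set \<Rightarrow> bool"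
  where "free_over_order A act R \<longleftrightarrow> (\<exists>\<beta> \<in> R. bij_betw (\<lambda>a. act a \<beta>) A R)"

end

theory Submission
  imports Defs "Jordan_Normal_Form.Char_Poly"
begin

text \<open>Since \<open>\<O>\<^sub>F\<close> is a free \<open>\<O>\<^sub>K\<close>-module with a basis \<open>z\<^sub>1, \<dots>, z\<^sub>d\<close>, which is also a
  \<open>K\<close>-basis of \<open>F\<close>, arithmetic disjointness gives \<open>L = \<Oplus> E z\<^sub>i\<close> and \<open>\<O>\<^sub>L = \<Oplus> \<O>\<^sub>E z\<^sub>i\<close>. Every
  element of \<open>H\<^sub>1 \<otimes> F\<close> is uniquely \<open>\<Sum> h\<^sub>i \<otimes> z\<^sub>i\<close>, and it maps \<open>\<alpha> \<in> E\<close> to \<open>\<Sum> (h\<^sub>i \<cdot> \<alpha>) z\<^sub>i\<close>; as \<open>H\<^sub>1\<close>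
  maps \<open>E\<close> to itself, comparing coefficients shows that it preserves \<open>\<O>\<^sub>L\<close> exactly if all \<open>h\<^sub>i\<close> preserve
  \<open>\<O>\<^sub>E\<close>. The same comparison shows that a free generator of \<open>\<O>\<^sub>E\<close> is a free generator of
  \<open>\<O>\<^sub>L\<close>.\<close>

section \<open>Integral closures\<close>

text \<open>Freeness of the ring of integers rests on the trace form: the functionals
  \<open>x \<mapsto> Tr (f x)\<close>, scaled so that they take values in \<open>R\<close>, embed it
  in a free module. Their joint injectivity comes from a single tensor in
  \<open>L \<otimes> L\<close> that acts as the indicator of the identity on the Galois group. A
  tensor of the same kind with entries in \<open>F\<close> shows \<open>L = EF\<close>, so that the
  condition on the integers of \<open>EF\<close> becomes one on \<open>\<O>\<^sub>L\<close>. Linear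
  disjointness gives uniqueness of coefficients in \<open>E\<close>, and surjectivity onto
  \<open>\<O>\<^sub>L\<close> gives their integrality. That \<open>H\<^sub>1\<close> preserves
  \<open>E\<close> is Galois descent: for \<tau> in \<open>G'\<close> the permutation
  \<open>lambda_c J G' \<tau>\<close> is conjugation by \<tau> and fixes the identity of
  \<open>J\<close>. Tensors are cosets in a free abelian group and maps out of them are definite
  descriptions, which can be evaluated only once balancedness is known; hence all computations pass
  through the normal form \<open>tsum\<close>.\<close>

locale field_subring =
  fixes R :: "'a::field set"
  assumes zero_mem: "0 \<in> R" and one_mem: "1 \<in> R"
    and add_mem: "x \<in> R \<Longrightarrow> y \<in> R \<Longrightarrow> x + y \<in> R"
    and uminus_mem: "x \<in> R \<Longrightarrow> - x \<in> R"
    and mult_mem: "x \<in> R \<Longrightarrow> y \<in> R \<Longrightarrow> x * y \<in> R"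
begin

lemma diff_mem: "x \<in> R \<Longrightarrow> y \<in> R \<Longrightarrow> x - y \<in> R"
  using add_mem[of x "- y"] uminus_mem by simp

lemma sum_mem: "(\<And>i. i \<in> I \<Longrightarrow> f i \<in> R) \<Longrightarrow> sum f I \<in> R"
  by (induction I rule: infinite_finite_induct) (auto intro: zero_mem add_mem)

lemma power_mem: "x \<in> R \<Longrightarrow> x ^ n \<in> R"
  by (induction n) (auto intro: one_mem mult_mem)

text \<open>Moving the lower terms to the other side turns a monic equation into a rewriting rule
  for \<open>x ^ n\<close>. The proofs that exploit integrality work with this form.\<close>

lemma integral_closure_iff:
  "x \<in> integral_closure R M \<longleftrightarrow>
     x \<in> M \<and> (\<exists>n c. (\<forall>i. c i \<in> R) \<and> x ^ n = (\<Sum>i<n. c i * x ^ i))"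
proof (intro iffI conjI)
  assume x: "x \<in> integral_closure R M"
  then show "x \<in> M" by (simp add: integral_closure_def)
  from x obtain p where p: "range (Polynomial.coeff p) \<subseteq> R" "Polynomial.lead_coeff p = 1" "Polynomial.poly p x = 0"
    by (auto simp: integral_closure_def)
  have "0 = (\<Sum>i<Polynomial.degree p. Polynomial.coeff p i * x ^ i) + x ^ Polynomial.degree p"
    using p(2,3) by (simp add: poly_altdef flip: lessThan_Suc_atMost)
  then have "x ^ Polynomial.degree p = (\<Sum>i<Polynomial.degree p. (- Polynomial.coeff p i) * x ^ i)"
    by (simp add: sum_negf eq_neg_iff_add_eq_0 add.commute)
  with p(1) show "\<exists>n c. (\<forall>i. c i \<in> R) \<and> x ^ n = (\<Sum>i<n. c i * x ^ i)"
    by (intro exI[of _ "Polynomial.degree p"] exI[of _ "\<lambda>i. - Polynomial.coeff p i"]) (auto intro: uminus_mem)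
next
  assume "x \<in> M \<and> (\<exists>n c. (\<forall>i. c i \<in> R) \<and> x ^ n = (\<Sum>i<n. c i * x ^ i))"
  then obtain n c where x: "x \<in> M" and c: "\<And>i. c i \<in> R" and eq: "x ^ n = (\<Sum>i<n. c i * x ^ i)"
    by auto
  define p where "p = Polynomial.monom 1 n - (\<Sum>i<n. Polynomial.monom (c i) i)"
  have coeff: "Polynomial.coeff p k = (if k = n then 1 else if k < n then - c k else 0)" for k
    by (simp add: p_def coeff_sum)
  have "Polynomial.degree p = n"
  proof (rule antisym)
    show "Polynomial.degree p \<le> n" by (rule degree_le) (simp add: coeff)
    show "n \<le> Polynomial.degree p" by (rule le_degree) (simp add: coeff)
  qed
  moreover have "Polynomial.poly p x = 0"
    using eq by (simp add: p_def poly_sum poly_monom)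
  moreover have "range (Polynomial.coeff p) \<subseteq> R"
    using c by (auto simp: coeff zero_mem one_mem uminus_mem)
  ultimately show "x \<in> integral_closure R M"
    unfolding integral_closure_def using x by (intro CollectI conjI exI[of _ p]) (simp_all add: coeff)
qed

section \<open>Finite spans and the determinant trick\<close>

definition rspan :: "'a set \<Rightarrow> 'a set"
  where "rspan B = {\<Sum>b\<in>B. c b * b | c. \<forall>b\<in>B. c b \<in> R}"

lemma rspan_zero: "0 \<in> rspan B"
  unfolding rspan_def by (rule CollectI, rule exI[of _ "\<lambda>_. 0"]) (auto intro: zero_mem)

lemma rspan_add:
  assumes "x \<in> rspan B" "y \<in> rspan B" shows "x + y \<in> rspan B"
proof -
  from assms obtain c d where "\<forall>b\<in>B. c b \<in> R" "\<forall>b\<in>B. d b \<in> R"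
    "x = (\<Sum>b\<in>B. c b * b)" "y = (\<Sum>b\<in>B. d b * b)" by (auto simp: rspan_def)
  then show ?thesis unfolding rspan_def
    by (intro CollectI exI[of _ "\<lambda>b. c b + d b"]) (auto simp: sum.distrib distrib_right intro: add_mem)
qed

lemma rspan_scale:
  assumes "x \<in> rspan B" "r \<in> R" shows "r * x \<in> rspan B"
proof -
  from assms obtain c where "\<forall>b\<in>B. c b \<in> R" "x = (\<Sum>b\<in>B. c b * b)" by (auto simp: rspan_def)
  then show ?thesis unfolding rspan_def using assms
    by (intro CollectI exI[of _ "\<lambda>b. r * c b"]) (auto simp: sum_distrib_left mult.assoc intro: mult_mem)
qed

lemma rspan_sum: "(\<And>i. i \<in> I \<Longrightarrow> f i \<in> rspan B) \<Longrightarrow> sum f I \<in> rspan B"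
  by (induction I rule: infinite_finite_induct) (auto intro: rspan_zero rspan_add)

lemma rspan_base:
  assumes "finite B" "b \<in> B" shows "b \<in> rspan B"
  unfolding rspan_def
proof (intro CollectI exI[of _ "\<lambda>b'. if b' = b then 1 else 0"] conjI)
  have "(\<Sum>b'\<in>B. (if b' = b then 1 else 0) * b') = (\<Sum>b'\<in>B. if b' = b then b else 0)"
    by (intro sum.cong) auto
  then show "b = (\<Sum>b'\<in>B. (if b' = b then 1 else 0) * b')" using assms by simp
qed (auto intro: zero_mem one_mem)

lemma rspan_mult:
  assumes "\<And>b. b \<in> B \<Longrightarrow> x * b \<in> rspan B" "m \<in> rspan B" shows "x * m \<in> rspan B"
proof -
  from assms(2) obtain c where c: "\<forall>b\<in>B. c b \<in> R" "m = (\<Sum>b\<in>B. c b * b)" by (auto simp: rspan_def)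
  have "x * m = (\<Sum>b\<in>B. c b * (x * b))" by (simp add: c sum_distrib_left mult_ac)
  also have "\<dots> \<in> rspan B" using assms(1) c by (auto intro: rspan_sum rspan_scale)
  finally show ?thesis .
qed

text \<open>The polynomials with coefficients in \<open>R\<close> form a subring \<open>S\<close>
  that contains the entries of the characteristic matrix; the Leibniz formula builds the determinant
  from them by sums, products and signs.\<close>

lemma char_poly_coeff_mem:
  assumes A: "A \<in> carrier_mat n n" and AR: "\<And>i j. i < n \<Longrightarrow> j < n \<Longrightarrow> A $$ (i, j) \<in> R"
  shows "range (Polynomial.coeff (char_poly A)) \<subseteq> R"
proof -
  define S where "S = {p :: 'a Polynomial.poly. range (Polynomial.coeff p) \<subseteq> R}"
  have S0: "0 \<in> S" and S1: "1 \<in> S"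
    by (auto simp: S_def zero_mem one_mem coeff_1)
  have Sadd: "p + q \<in> S" if "p \<in> S" "q \<in> S" for p q
    using that by (auto simp: S_def intro!: add_mem)
  have Smult: "p * q \<in> S" if "p \<in> S" "q \<in> S" for p q
    using that by (auto simp: S_def coeff_mult intro!: sum_mem mult_mem)
  have Ssum: "sum f I \<in> S" if "\<And>i. i \<in> I \<Longrightarrow> f i \<in> S" for f :: "(nat \<Rightarrow> nat) \<Rightarrow> _" and I
    using that by (induction I rule: infinite_finite_induct) (auto intro: S0 Sadd)
  have Sprod: "prod f I \<in> S" if "\<And>i. i \<in> I \<Longrightarrow> f i \<in> S" for f :: "nat \<Rightarrow> _" and I
    using that by (induction I rule: infinite_finite_induct) (auto intro: S1 Smult)
  have Ssign: "of_int (sign p) \<in> S" for p :: "nat \<Rightarrow> nat"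
    by (auto simp: S_def sign_def coeff_1 zero_mem one_mem uminus_mem)
  have Sentry: "char_poly_matrix A $$ (i, j) \<in> S" if "i < n" "j < n" for i j
    using that A AR by (auto simp: S_def char_poly_matrix_def coeff_pCons zero_mem one_mem uminus_mem add_mem diff_mem split: nat.splits)
  have perm: "p i < n" if "p permutes {0..<n}" "i < n" for p i
    using permutes_in_image[OF that(1), of i] that(2) by simp
  have "det (char_poly_matrix A) = (\<Sum>p\<in>{p. p permutes {0..<n}}. of_int (sign p) * (\<Prod>i = 0..<n. char_poly_matrix A $$ (i, p i)))"
    using A by (simp add: det_def char_poly_matrix_def)
  also have "\<dots> \<in> S"
    by (intro Ssum Smult Sprod Ssign Sentry) (auto intro: perm)
  finally have "det (char_poly_matrix A) \<in> S" .
  then show ?thesis by (simp add: S_def char_poly_def)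
qed

text \<open>Determinant trick: multiplication by \<open>x\<close> on the generators is described by
  a matrix over \<open>R\<close>, for which the vector of generators is an eigenvector with
  eigenvalue \<open>x\<close>. Hence \<open>x\<close> is a root of its characteristic polynomial,
  which is monic over \<open>R\<close>. The generator \<open>b0\<close> makes the eigenvector
  nonzero.\<close>

lemma integral_if_stable_span:
  assumes fin: "finite B" and nz: "b0 \<in> B" "b0 \<noteq> 0" and stable: "\<And>b. b \<in> B \<Longrightarrow> x * b \<in> rspan B"
    and xM: "x \<in> M"
  shows "x \<in> integral_closure R M"
proof -
  obtain bs where bs: "set bs = B" "distinct bs" using fin finite_distinct_list by blast
  define n where "n = length bs"
  have reindex: "(\<Sum>b\<in>B. g b) = (\<Sum>i<n. g (bs ! i))" for g :: "'a \<Rightarrow> 'a"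
    by (rule sum.reindex_bij_betw[symmetric]) (use bs bij_betw_nth[of bs] in \<open>simp add: n_def\<close>)
  from stable have "\<forall>b\<in>B. \<exists>c. (\<forall>b'\<in>B. c b' \<in> R) \<and> x * b = (\<Sum>b'\<in>B. c b' * b')"
    by (auto simp: rspan_def)
  then obtain a where a: "\<And>b b'. b \<in> B \<Longrightarrow> b' \<in> B \<Longrightarrow> a b b' \<in> R"
    and eq: "\<And>b. b \<in> B \<Longrightarrow> x * b = (\<Sum>b'\<in>B. a b b' * b')"
    by metis
  define A where "A = mat n n (\<lambda>(i, j). a (bs ! i) (bs ! j))"
  define v where "v = vec n (\<lambda>i. bs ! i)"
  have A: "A \<in> carrier_mat n n" by (simp add: A_def)
  obtain k where k: "k < n" "bs ! k = b0" using nz bs by (metis in_set_conv_nth n_def)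
  have "v \<noteq> 0\<^sub>v n" using k nz by (auto simp: v_def vec_eq_iff)
  moreover have "A *\<^sub>v v = x \<cdot>\<^sub>v v"
  proof (rule eq_vecI)
    fix i assume "i < dim_vec (x \<cdot>\<^sub>v v)"
    then have i: "i < n" by (simp add: v_def)
    then have "bs ! i \<in> B" using bs by (auto simp: n_def)
    then have "(\<Sum>j<n. a (bs ! i) (bs ! j) * bs ! j) = x * bs ! i" by (simp add: eq reindex)
    with i show "(A *\<^sub>v v) $ i = (x \<cdot>\<^sub>v v) $ i"
      by (simp add: A_def v_def scalar_prod_def atLeast0LessThan)
  qed (simp add: A_def v_def)
  ultimately have "eigenvector A v x" by (auto simp: eigenvector_def A_def v_def)
  then have "Polynomial.poly (char_poly A) x = 0"
    using eigenvalue_root_char_poly[OF A] by (auto simp: eigenvalue_def)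
  moreover have "range (Polynomial.coeff (char_poly A)) \<subseteq> R"
    using bs by (intro char_poly_coeff_mem[OF A]) (auto simp: A_def n_def intro!: a)
  ultimately show ?thesis
    using degree_monic_char_poly[OF A] xM unfolding integral_closure_def by blast
qed

text \<open>The generators are the monomials \<open>x ^ i * y ^ j\<close> with exponents below the
  degrees of the two integral equations. A span stable under \<open>x\<close> and \<open>y\<close>
  is stable under \<open>x + y\<close> and \<open>x * y\<close>, so one set serves both closure
  properties.\<close>

lemma integral_pair_span:
  assumes "x \<in> integral_closure R UNIV" "y \<in> integral_closure R UNIV"
  obtains B where "finite B" "1 \<in> B" "\<And>b. b \<in> B \<Longrightarrow> x * b \<in> rspan B" "\<And>b. b \<in> B \<Longrightarrow> y * b \<in> rspan B"
proof -
  obtain n c where c: "\<And>i. c i \<in> R" and x: "x ^ n = (\<Sum>i<n. c i * x ^ i)"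
    using assms(1) by (auto simp: integral_closure_iff)
  obtain m d where d: "\<And>i. d i \<in> R" and y: "y ^ m = (\<Sum>i<m. d i * y ^ i)"
    using assms(2) by (auto simp: integral_closure_iff)
  define B where "B = (\<lambda>(i, j). x ^ i * y ^ j) ` ({..<n} \<times> {..<m})"
  \<comment> \<open>For \<open>n = 0\<close> the equation would read \<open>1 = 0\<close>, the sum
    being empty.\<close>
  have n: "n > 0" using x by (cases n) auto
  have m: "m > 0" using y by (cases m) auto
  have fin: "finite B" by (simp add: B_def)
  have base: "x ^ i * y ^ j \<in> rspan B" if "i < n" "j < m" for i j
    using that by (intro rspan_base[OF fin]) (auto simp: B_def)
  have "x * b \<in> rspan B" if b: "b \<in> B" for b
  proof -
    obtain i j where ij: "i < n" "j < m" "b = x ^ i * y ^ j" using b by (auto simp: B_def)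
    show ?thesis
    proof (cases "Suc i < n")
      case True
      then show ?thesis using base[of "Suc i" j] ij by (simp add: mult_ac)
    next
      case False
      then have "x * b = x ^ n * y ^ j" using ij less_antisym by fastforce
      also have "\<dots> = (\<Sum>i<n. c i * (x ^ i * y ^ j))" by (simp add: x sum_distrib_right mult.assoc)
      also have "\<dots> \<in> rspan B"
        by (rule rspan_sum, rule rspan_scale) (use base ij c in auto)
      finally show ?thesis .
    qed
  qed
  moreover have "y * b \<in> rspan B" if b: "b \<in> B" for b
  proof -
    obtain i j where ij: "i < n" "j < m" "b = x ^ i * y ^ j" using b by (auto simp: B_def)
    show ?thesis
    proof (cases "Suc j < m")
      case True
      then show ?thesis using base[of i "Suc j"] ij by (simp add: mult_ac)
    next
      case False
      then have "m = Suc j" using ij by simp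
      then have "y * b = x ^ i * y ^ m" using ij by simp
      also have "\<dots> = (\<Sum>j<m. d j * (x ^ i * y ^ j))" by (simp add: y sum_distrib_left mult_ac)
      also have "\<dots> \<in> rspan B"
        by (rule rspan_sum, rule rspan_scale) (use base ij d in auto)
      finally show ?thesis .
    qed
  qed
  moreover have "1 \<in> B" using n m by (force simp: B_def)
  ultimately show thesis using that fin by blast
qed

lemma integral_self: "r \<in> R \<Longrightarrow> r \<in> integral_closure R UNIV"
  unfolding integral_closure_iff by (intro conjI UNIV_I exI[of _ 1] exI[of _ "\<lambda>_. r"]) auto

lemma integral_add:
  assumes "x \<in> integral_closure R UNIV" "y \<in> integral_closure R UNIV"
  shows "x + y \<in> integral_closure R UNIV"
proof -
  from assms obtain B where B: "finite B" "1 \<in> B" "\<And>b. b \<in> B \<Longrightarrow> x * b \<in> rspan B" "\<And>b. b \<in> B \<Longrightarrow> y * b \<in> rspan B"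
    by (rule integral_pair_span) blast
  show ?thesis
    by (rule integral_if_stable_span[OF B(1,2)]) (auto simp: distrib_right intro: rspan_add B)
qed

lemma integral_mult:
  assumes "x \<in> integral_closure R UNIV" "y \<in> integral_closure R UNIV"
  shows "x * y \<in> integral_closure R UNIV"
proof -
  from assms obtain B where B: "finite B" "1 \<in> B" "\<And>b. b \<in> B \<Longrightarrow> x * b \<in> rspan B" "\<And>b. b \<in> B \<Longrightarrow> y * b \<in> rspan B"
    by (rule integral_pair_span) blast
  show ?thesis
    by (rule integral_if_stable_span[OF B(1,2)]) (auto simp: mult.assoc intro: rspan_mult B(3,4))
qed

lemma integral_closure_Int: "integral_closure R M = integral_closure R UNIV \<inter> M"
  by (auto simp: integral_closure_def)

lemma field_subring_integral_closure:
  assumes "field_subring M"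
  shows "field_subring (integral_closure R M)"
proof -
  interpret M: field_subring M by fact
  have "- x \<in> integral_closure R UNIV" if "x \<in> integral_closure R UNIV" for x
    using integral_mult[OF integral_self[OF uminus_mem[OF one_mem]] that] by simp
  then show ?thesis unfolding integral_closure_Int[of M]
    by unfold_locales (auto intro: integral_self zero_mem one_mem M.zero_mem M.one_mem integral_add M.add_mem
      M.uminus_mem integral_mult M.mult_mem)
qed

end


section \<open>Subrings that are principal ideal domains\<close>

lemma top_ring_simps [simp]:
  "carrier top_ring = UNIV" "x \<otimes>\<^bsub>top_ring\<^esub> y = x * y" "x \<oplus>\<^bsub>top_ring\<^esub> y = x + y"
  "\<one>\<^bsub>top_ring\<^esub> = 1" "\<zero>\<^bsub>top_ring\<^esub> = 0"
  by (simp_all add: ring_of_type_algebra_def)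

lemma (in field_subring) cring_subring_of: "cring (subring_of R)"
proof (intro cringI abelian_groupI comm_monoidI)
  show "\<exists>y\<in>carrier (subring_of R). y \<oplus>\<^bsub>subring_of R\<^esub> x = \<zero>\<^bsub>subring_of R\<^esub>" if "x \<in> carrier (subring_of R)" for x
    using that by (auto intro!: bexI[of _ "- x"] uminus_mem)
qed (auto simp: algebra_simps intro: zero_mem one_mem add_mem mult_mem)

lemma field_subring_if_cring:
  assumes "cring (subring_of R)" shows "field_subring R"
proof -
  interpret cring "subring_of R" by fact
  show ?thesis
  proof
    show "- x \<in> R" if x: "x \<in> R" for x
    proof -
      obtain y where "y \<in> R" "y + x = 0" using add.l_inv_ex[of x] x by auto
      then show ?thesis using eq_neg_iff_add_eq_0 by metis
    qed
  qed (use zero_closed one_closed a_closed m_closed in auto)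
qed

lemma field_subring_if_subfield:
  assumes "subfield K top_ring" shows "field_subring K"
  using ring.subfield_iff(2)[OF ring_from_type_algebra] assms
  by (intro field_subring_if_cring) (auto simp: field_def domain_def)

lemma field_inverse_mem:
  assumes "subfield K top_ring" "x \<in> K" shows "inverse x \<in> K"
proof (cases "x = 0")
  case False
  interpret T: field "top_ring :: 'a ring" by (rule field_from_type_algebra)
  have "inv\<^bsub>top_ring\<^esub> x = inverse x"
    using False by (intro T.inv_char) auto
  moreover have "inv\<^bsub>top_ring\<^esub> x \<in> K"
    using T.subfield_m_inv(1)[OF assms(1)] assms(2) False by auto
  ultimately show ?thesis by simp
qed (use assms in simp)

locale pid_subring =
  fixes R :: "'a::field set"
  assumes principal_domain: "principal_domain (subring_of R)"

sublocale pid_subring \<subseteq> field_subring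
  using principal_domain by (intro field_subring_if_cring) (auto simp: principal_domain_def domain_def)

context pid_subring
begin

text \<open>Ideals enter as plain subsets of the field, so that callers need not handle ideals of
  ring records. It is applied to the denominators of a fraction and to the image of a linear
  functional.\<close>

lemma ideal_generator:
  assumes sub: "I \<subseteq> R" and zero_in: "0 \<in> I" and add: "\<And>x y. x \<in> I \<Longrightarrow> y \<in> I \<Longrightarrow> x + y \<in> I"
    and scale: "\<And>r x. r \<in> R \<Longrightarrow> x \<in> I \<Longrightarrow> r * x \<in> I"
  shows "\<exists>a\<in>I. \<forall>x\<in>I. \<exists>r\<in>R. x = r * a"
proof -
  interpret principal_domain "subring_of R" by (rule principal_domain)
  have "ideal I (subring_of R)"
  proof (rule idealI)
    show "ring (subring_of R)" by (rule ring_axioms)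
    have neg: "- x \<in> I" if "x \<in> I" for x
      using scale[OF uminus_mem[OF one_mem] that] by simp
    show "subgroup I (add_monoid (subring_of R))"
    proof (rule add.subgroupI)
      show "I \<subseteq> carrier (subring_of R)" using sub by simp
      show "I \<noteq> {}" using zero_in by blast
      show "\<ominus>\<^bsub>subring_of R\<^esub> x \<in> I" if x: "x \<in> I" for x
      proof -
        have "- x \<in> R" "x \<in> R" using x sub neg by auto
        then have "\<ominus>\<^bsub>subring_of R\<^esub> x = - x" by (intro minus_equality) auto
        then show ?thesis using neg[OF x] by simp
      qed
      show "x \<oplus>\<^bsub>subring_of R\<^esub> y \<in> I" if "x \<in> I" "y \<in> I" for x y
        using add[OF that] by simp
    qed
    show "x \<otimes>\<^bsub>subring_of R\<^esub> a \<in> I" "a \<otimes>\<^bsub>subring_of R\<^esub> x \<in> I" if "a \<in> I" "x \<in> carrier (subring_of R)" for a x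
      using scale[of x a] that by (simp_all add: mult.commute[of a])
  qed
  then obtain a where a: "a \<in> R" "I = PIdl\<^bsub>subring_of R\<^esub> a" using exists_gen by auto
  then have "I = {r * a | r. r \<in> R}" by (auto simp: cgenideal_def)
  then show ?thesis using one_mem by (intro bexI[of _ a]) (auto intro: exI[of _ 1])
qed

text \<open>The elements \<open>r\<close> of \<open>R\<close> for which every
  \<open>r * x ^ k\<close> stays in \<open>R\<close> form an ideal that multiplication by
  \<open>x\<close> maps into itself. It contains a power of the denominator of \<open>x\<close>,
  hence is nonzero, and cancelling its generator \<open>e\<close> from \<open>x * e = r * e\<close>
  gives \<open>x = r\<close>. No gcd is involved.\<close>

lemma integrally_closed:
  assumes "x \<in> quotient_field R" "x \<in> integral_closure R UNIV"
  shows "x \<in> R"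
proof -
  obtain a b where ab: "a \<in> R" "b \<in> R" "b \<noteq> 0" "x = a / b"
    using assms(1) by (auto simp: quotient_field_def)
  obtain n c where c: "\<And>i. c i \<in> R" and x: "x ^ n = (\<Sum>i<n. c i * x ^ i)"
    using assms(2) by (auto simp: integral_closure_iff)
  \<comment> \<open>\<open>b ^ n\<close> clears the denominators of the powers below
    \<open>n\<close>; the integral equation carries this on to all higher powers.\<close>
  have bn: "b ^ n * x ^ k \<in> R" for k
  proof (induction k rule: less_induct)
    case (less k)
    show ?case
    proof (cases "k < n")
      case True
      then have "b ^ n * x ^ k = b ^ (n - k) * a ^ k"
        using ab by (simp add: power_divide power_diff)
      then show ?thesis using ab by (simp add: mult_mem power_mem)
    next
      case False
      then have "x ^ k = x ^ (k - n) * x ^ n" by (simp flip: power_add)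
      then have "b ^ n * x ^ k = (\<Sum>i<n. c i * (b ^ n * x ^ (k - n + i)))"
        by (simp add: x sum_distrib_left power_add mult_ac del: diff_add_assoc2)
      also have "\<dots> \<in> R"
        by (rule sum_mem, rule mult_mem[OF c], rule less.IH) (use False in auto)
      finally show ?thesis .
    qed
  qed
  define I where "I = {r \<in> R. \<forall>k. r * x ^ k \<in> R}"
  have xI: "x * r \<in> I" if "r \<in> I" for r
  proof -
    have "r * x ^ Suc k \<in> R" for k using that unfolding I_def by blast
    from this[of 0] this show ?thesis by (auto simp: I_def mult_ac)
  qed
  have "\<exists>e\<in>I. \<forall>y\<in>I. \<exists>r\<in>R. y = r * e"
    by (rule ideal_generator) (auto simp: I_def distrib_right mult.assoc zero_mem intro: add_mem mult_mem)
  then obtain e where e: "e \<in> I" "\<And>y. y \<in> I \<Longrightarrow> \<exists>r\<in>R. y = r * e" by blast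
  have "b ^ n \<in> I" using bn ab by (simp add: I_def power_mem)
  then have "e \<noteq> 0" using e(2) ab by fastforce
  moreover obtain r where "r \<in> R" "x * e = r * e" using e(2)[OF xI[OF e(1)]] by blast
  ultimately show ?thesis by simp
qed

end

section \<open>Free modules over a principal ideal domain\<close>

definition module_basis :: "'a::field set \<Rightarrow> 'a set \<Rightarrow> (nat \<Rightarrow> 'a) \<Rightarrow> nat \<Rightarrow> bool"
  where "module_basis R M z d \<longleftrightarrow>
    M = {\<Sum>i<d. c i * z i | c. \<forall>i<d. c i \<in> R} \<and>
    (\<forall>c. (\<forall>i<d. c i \<in> R) \<longrightarrow> (\<Sum>i<d. c i * z i) = 0 \<longrightarrow> (\<forall>i<d. c i = 0))"

text \<open>Induction on the functionals. The image of \<open>M\<close> under the first one,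
  \<open>f\<close>, is an ideal with generator \<open>a = f m\<close>. If \<open>a\<close> is
  nonzero, \<open>M\<close> is the direct sum of the kernel of \<open>f\<close> on \<open>M\<close>
  and the free module on \<open>m\<close>, and on that kernel the remaining functionals still
  separate. Linearity is asked on the whole field, so it passes unchanged to the smaller module.
  Finite generation of \<open>M\<close> comes out rather than goes in.\<close>

lemma (in pid_subring) free_if_separated:
  assumes zero: "0 \<in> M" and add: "\<And>x y. x \<in> M \<Longrightarrow> y \<in> M \<Longrightarrow> x + y \<in> M"
    and scale: "\<And>r x. r \<in> R \<Longrightarrow> x \<in> M \<Longrightarrow> r * x \<in> M"
    and f_add: "\<And>(f :: 'a \<Rightarrow> 'a) x y. f \<in> set fs \<Longrightarrow> f (x + y) = f x + f y"
    and f_scale: "\<And>f r x. f \<in> set fs \<Longrightarrow> r \<in> R \<Longrightarrow> f (r * x) = r * f x"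
    and f_mem: "\<And>f x. f \<in> set fs \<Longrightarrow> x \<in> M \<Longrightarrow> f x \<in> R"
    and separated: "\<And>x. x \<in> M \<Longrightarrow> (\<And>f. f \<in> set fs \<Longrightarrow> f x = 0) \<Longrightarrow> x = 0"
  shows "\<exists>z d. module_basis R M z d"
  using assms
proof (induction fs arbitrary: M)
  case Nil
  then have "M = {0}" by auto
  then have "module_basis R M (\<lambda>_. 0) 0" by (auto simp: module_basis_def)
  then show ?case by blast
next
  case (Cons f fs)
  note M = Cons.prems(1-3)
  have f: "f (x + y) = f x + f y" "r \<in> R \<Longrightarrow> f (r * x) = r * f x" "x \<in> M \<Longrightarrow> f x \<in> R" for x y r
    using Cons.prems(4-6) by auto
  have f0: "f 0 = 0" using f(1)[of 0 0] by (metis add_cancel_right_right)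
  have fneg: "f (- x) = - f x" for x using f(1)[of x "- x"] f0 by (simp add: eq_neg_iff_add_eq_0 add.commute)
  have Mneg: "- x \<in> M" if "x \<in> M" for x
    using M(3)[OF uminus_mem[OF one_mem] that] by simp
  define M' where "M' = {x \<in> M. f x = 0}"
  have "\<exists>z d. module_basis R M' z d"
  proof (rule Cons.IH)
    show "x = 0" if x: "x \<in> M'" and sep: "\<And>g. g \<in> set fs \<Longrightarrow> g x = 0" for x
    proof (rule Cons.prems(7))
      show "x \<in> M" using x by (simp add: M'_def)
      show "g x = 0" if "g \<in> set (f # fs)" for g
        using that x sep by (auto simp: M'_def)
    qed
    show "x + y \<in> M'" if "x \<in> M'" "y \<in> M'" for x y
      using that M(2) by (simp add: M'_def f(1))
    show "r * x \<in> M'" if "r \<in> R" "x \<in> M'" for r x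
      using that M(3) by (simp add: M'_def f(2))
    show "g (x + y) = g x + g y" if "g \<in> set fs" for g x y
      using that Cons.prems(4) by simp
    show "g (r * x) = r * g x" if "g \<in> set fs" "r \<in> R" for g r x
      using that Cons.prems(5) by simp
    show "g x \<in> R" if "g \<in> set fs" "x \<in> M'" for g x
      using that Cons.prems(6) by (simp add: M'_def)
  qed (use M(1) f0 in \<open>simp add: M'_def\<close>)
  then obtain z d where zd0: "module_basis R M' z d" by blast
  then have zd: "M' = {\<Sum>i<d. c i * z i | c. \<forall>i<d. c i \<in> R}"
    "\<And>c i. \<forall>i<d. c i \<in> R \<Longrightarrow> (\<Sum>i<d. c i * z i) = 0 \<Longrightarrow> i < d \<Longrightarrow> c i = 0"
    unfolding module_basis_def by simp_all
  have "\<exists>a\<in>f ` M. \<forall>y\<in>f ` M. \<exists>r\<in>R. y = r * a"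
  proof (rule ideal_generator)
    show "0 \<in> f ` M" using M(1) f0 by force
    show "x + y \<in> f ` M" if xy: "x \<in> f ` M" "y \<in> f ` M" for x y
    proof -
      obtain u v where "u \<in> M" "v \<in> M" "x = f u" "y = f v" using xy by blast
      then show ?thesis using M(2) f(1)[of u v] by (metis imageI)
    qed
    show "r * x \<in> f ` M" if rx: "r \<in> R" "x \<in> f ` M" for r x
    proof -
      obtain u where "u \<in> M" "x = f u" using rx by blast
      then show ?thesis using M(3)[of r u] f(2)[of r u] rx(1) by (metis imageI)
    qed
    show "f ` M \<subseteq> R" using f(3) by blast
  qed
  then obtain a where a: "a \<in> f ` M" "\<And>y. y \<in> f ` M \<Longrightarrow> \<exists>r\<in>R. y = r * a"
    by blast
  then obtain m where m: "m \<in> M" "f m = a" by auto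
  show ?case
  proof (cases "a = 0")
    case True
    \<comment> \<open>Here \<open>f\<close> vanishes on \<open>M\<close>, so no basis element is
      added.\<close>
    have "f x = 0" if "x \<in> M" for x using a(2)[of "f x"] that True by auto
    then have "M' = M" by (auto simp: M'_def)
    then show ?thesis using zd0 by blast
  next
    case False
    \<comment> \<open>The new generator goes to position \<open>d\<close>, just beyond the old
      basis, so the first \<open>d\<close> terms are unchanged.\<close>
    have upd: "(\<Sum>i<Suc d. c i * (z(d := m)) i) = (\<Sum>i<d. c i * z i) + c d * m" for c
      by simp
    have comb_M': "(\<Sum>i<d. c i * z i) \<in> M'" if "\<forall>i<d. c i \<in> R" for c
      unfolding zd(1) using that by (intro CollectI exI[of _ c]) simp
    have le: "\<exists>c. x = (\<Sum>i<Suc d. c i * (z(d := m)) i) \<and> (\<forall>i<Suc d. c i \<in> R)" if x: "x \<in> M" for x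
    proof -
      \<comment> \<open>\<open>r * m\<close> has the same value under \<open>f\<close> as
        \<open>x\<close>, so the difference falls into \<open>M'\<close>.\<close>
      obtain r where r: "r \<in> R" "f x = r * a" using a(2)[of "f x"] x by blast
      have rm: "r * m \<in> M" using M(3) r m by simp
      have "x + - (r * m) \<in> M" using M(2)[OF x Mneg[OF rm]] .
      moreover have "f (x + - (r * m)) = 0" using r m by (simp only: f(1) fneg f(2)) simp
      ultimately have "x + - (r * m) \<in> M'" by (simp add: M'_def)
      then obtain c where c: "\<forall>i<d. c i \<in> R" "x + - (r * m) = (\<Sum>i<d. c i * z i)"
        unfolding zd(1) by blast
      then have "x = (\<Sum>i<d. c i * z i) + r * m" by (simp add: algebra_simps)
      then have "x = (\<Sum>i<Suc d. (c(d := r)) i * (z(d := m)) i)" unfolding upd by simp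
      moreover have "\<forall>i<Suc d. (c(d := r)) i \<in> R" using c r by auto
      ultimately show ?thesis by metis
    qed
    have ge: "(\<Sum>i<Suc d. c i * (z(d := m)) i) \<in> M" if c: "\<forall>i<Suc d. c i \<in> R" for c
    proof -
      have "(\<Sum>i<d. c i * z i) \<in> M" "c d * m \<in> M"
        using comb_M'[of c] c M(3)[of "c d" m] m(1) by (auto simp: M'_def)
      then show ?thesis unfolding upd by (rule M(2))
    qed
    have indep: "c i = 0" if c: "\<forall>i<Suc d. c i \<in> R" "(\<Sum>i<Suc d. c i * (z(d := m)) i) = 0" and i: "i < Suc d" for c i
    proof -
      have eq: "(\<Sum>i<d. c i * z i) + c d * m = 0" using c(2) unfolding upd .
      \<comment> \<open>Applying \<open>f\<close> to the relation kills the old terms and leaves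
        \<open>c d * a\<close>; this isolates the last coefficient.\<close>
      have "f (\<Sum>i<d. c i * z i) = 0" using comb_M'[of c] c(1) by (simp add: M'_def)
      then have "c d * a = 0" using arg_cong[OF eq, of f] f0 c(1) m(2) by (simp add: f(1,2))
      then have cd: "c d = 0" using False by simp
      then have "(\<Sum>i<d. c i * z i) = 0" using eq by simp
      then have "c i = 0" if "i < d" using zd(2)[of c i] c(1) that by simp
      then show ?thesis using cd i less_Suc_eq by auto
    qed
    have "M = {\<Sum>i<Suc d. c i * (z(d := m)) i | c. \<forall>i<Suc d. c i \<in> R}"
    proof (intro equalityI subsetI)
      show "x \<in> {\<Sum>i<Suc d. c i * (z(d := m)) i | c. \<forall>i<Suc d. c i \<in> R}" if "x \<in> M" for x
        using le[OF that] by (rule CollectI)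
      show "x \<in> M" if "x \<in> {\<Sum>i<Suc d. c i * (z(d := m)) i | c. \<forall>i<Suc d. c i \<in> R}" for x
        using that ge by (elim CollectE exE conjE) (simp only: )
    qed
    then have "module_basis R M (z(d := m)) (Suc d)"
      unfolding module_basis_def using indep by (intro conjI allI impI) simp_all
    then show ?thesis by blast
  qed
qed


section \<open>Tensor products with a free module\<close>

text \<open>The clauses say that \<open>f\<close> respects the three families of relators and so
  factors through the tensor product. The target is an arbitrary multiplicative record: it will be
  the additive group of the field, that of a module, and another tensor product.\<close>

definition balanced_map ::
  "'r ring \<Rightarrow> ('r, 'm) module \<Rightarrow> ('r, 'n) module \<Rightarrow> ('c, 'x) monoid_scheme \<Rightarrow> ('m \<Rightarrow> 'n \<Rightarrow> 'c) \<Rightarrow> bool"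
  where "balanced_map R M N A f \<longleftrightarrow>
    (\<forall>m \<in> carrier M. \<forall>n \<in> carrier N. f m n \<in> carrier A) \<and>
    (\<forall>m \<in> carrier M. \<forall>m' \<in> carrier M. \<forall>n \<in> carrier N. f (m \<oplus>\<^bsub>M\<^esub> m') n = f m n \<otimes>\<^bsub>A\<^esub> f m' n) \<and>
    (\<forall>m \<in> carrier M. \<forall>n \<in> carrier N. \<forall>n' \<in> carrier N. f m (n \<oplus>\<^bsub>N\<^esub> n') = f m n \<otimes>\<^bsub>A\<^esub> f m n') \<and>
    (\<forall>r \<in> carrier R. \<forall>m \<in> carrier M. \<forall>n \<in> carrier N. f (r \<odot>\<^bsub>M\<^esub> m) n = f m (r \<odot>\<^bsub>N\<^esub> n))"

locale tensor_pair =
  fixes R :: "'r ring" and M :: "('r, 'm) module" and N :: "('r, 'n) module"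
  assumes module_left: "module R M" and module_right: "module R N"
begin

sublocale M: module R M by (rule module_left)
sublocale N: module R N by (rule module_right)

abbreviation "FG \<equiv> free_Abelian_group (carrier M \<times> carrier N)"
abbreviation "T \<equiv> tensor_product R M N"
abbreviation "ker \<equiv> tensor_kernel R M N"
abbreviation "pt \<equiv> pure_tensor R M N"

sublocale FG: comm_group FG by (rule abelian_free_Abelian_group)

lemma relators_carrier: "tensor_relators R M N \<subseteq> carrier FG"
proof -
  have "Poly_Mapping.keys (frag_of a - frag_of b - frag_of c) \<subseteq> {a, b, c}" for a b c :: "'m \<times> 'n"
    using keys_diff[of "frag_of a - frag_of b" "frag_of c"] keys_diff[of "frag_of a" "frag_of b"] by auto
  moreover have "Poly_Mapping.keys (frag_of a - frag_of b) \<subseteq> {a, b}" for a b :: "'m \<times> 'n"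
    using keys_diff[of "frag_of a" "frag_of b"] by auto
  ultimately show ?thesis
    unfolding tensor_relators_def carrier_free_Abelian_group_iff subset_iff by fastforce
qed

lemma ker_subgroup: "subgroup ker FG"
  unfolding tensor_kernel_def by (rule FG.generate_is_subgroup[OF relators_carrier])

lemma ker_normal: "ker \<lhd> FG"
  using ker_subgroup by (simp add: FG.normal_iff_subgroup)

sublocale T: comm_group T
  unfolding tensor_product_def by (rule FG.abelian_FactGroup[OF ker_subgroup])

lemma coset_hom: "(\<lambda>c. ker #>\<^bsub>FG\<^esub> c) \<in> hom FG T"
  unfolding tensor_product_def by (rule normal.r_coset_hom_Mod[OF ker_normal])

lemma coset_eq:
  assumes "x \<in> carrier FG" "y \<in> carrier FG" "x - y \<in> ker"
  shows "ker #>\<^bsub>FG\<^esub> x = ker #>\<^bsub>FG\<^esub> y"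
proof (rule FG.repr_independence[OF _ _ ker_subgroup, symmetric])
  show "x \<in> ker #>\<^bsub>FG\<^esub> y"
    unfolding r_coset_def using assms(3) by (auto intro!: bexI[of _ "x - y"])
qed (use assms in auto)

lemma frag_carrier: "m \<in> carrier M \<Longrightarrow> n \<in> carrier N \<Longrightarrow> frag_of (m, n) \<in> carrier FG"
  by simp

lemma relator_mem: "x \<in> tensor_relators R M N \<Longrightarrow> x \<in> ker"
  unfolding tensor_kernel_def by (rule generate.incl)

lemma pure_closed [intro]: "m \<in> carrier M \<Longrightarrow> n \<in> carrier N \<Longrightarrow> pt m n \<in> carrier T"
  unfolding pure_tensor_def using coset_hom frag_carrier by (meson hom_in_carrier)

lemma pure_add_left:
  assumes "m \<in> carrier M" "m' \<in> carrier M" "n \<in> carrier N"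
  shows "pt (m \<oplus>\<^bsub>M\<^esub> m') n = pt m n \<otimes>\<^bsub>T\<^esub> pt m' n"
proof -
  have "pt m n \<otimes>\<^bsub>T\<^esub> pt m' n = ker #>\<^bsub>FG\<^esub> (frag_of (m, n) + frag_of (m', n))"
    unfolding pure_tensor_def using hom_mult[OF coset_hom] assms frag_carrier
    by (metis mult_free_Abelian_group)
  moreover have "ker #>\<^bsub>FG\<^esub> frag_of (m \<oplus>\<^bsub>M\<^esub> m', n) = ker #>\<^bsub>FG\<^esub> (frag_of (m, n) + frag_of (m', n))"
  proof (rule coset_eq)
    show "frag_of (m, n) + frag_of (m', n) \<in> carrier FG"
      using FG.m_closed[of "frag_of (m, n)" "frag_of (m', n)"] assms by simp
    have "frag_of (m \<oplus>\<^bsub>M\<^esub> m', n) - frag_of (m, n) - frag_of (m', n) \<in> ker"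
      by (rule relator_mem) (use assms in \<open>auto simp: tensor_relators_def\<close>)
    then show "frag_of (m \<oplus>\<^bsub>M\<^esub> m', n) - (frag_of (m, n) + frag_of (m', n)) \<in> ker"
      by (simp add: algebra_simps)
  qed (use assms in auto)
  ultimately show ?thesis by (simp add: pure_tensor_def)
qed

lemma pure_add_right:
  assumes "m \<in> carrier M" "n \<in> carrier N" "n' \<in> carrier N"
  shows "pt m (n \<oplus>\<^bsub>N\<^esub> n') = pt m n \<otimes>\<^bsub>T\<^esub> pt m n'"
proof -
  have "pt m n \<otimes>\<^bsub>T\<^esub> pt m n' = ker #>\<^bsub>FG\<^esub> (frag_of (m, n) + frag_of (m, n'))"
    unfolding pure_tensor_def using hom_mult[OF coset_hom] assms frag_carrier
    by (metis mult_free_Abelian_group)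
  moreover have "ker #>\<^bsub>FG\<^esub> frag_of (m, n \<oplus>\<^bsub>N\<^esub> n') = ker #>\<^bsub>FG\<^esub> (frag_of (m, n) + frag_of (m, n'))"
  proof (rule coset_eq)
    show "frag_of (m, n) + frag_of (m, n') \<in> carrier FG"
      using FG.m_closed[of "frag_of (m, n)" "frag_of (m, n')"] assms by simp
    have "frag_of (m, n \<oplus>\<^bsub>N\<^esub> n') - frag_of (m, n) - frag_of (m, n') \<in> ker"
      by (rule relator_mem) (use assms in \<open>auto simp: tensor_relators_def\<close>)
    then show "frag_of (m, n \<oplus>\<^bsub>N\<^esub> n') - (frag_of (m, n) + frag_of (m, n')) \<in> ker"
      by (simp add: algebra_simps)
  qed (use assms in auto)
  ultimately show ?thesis by (simp add: pure_tensor_def)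
qed

lemma pure_balanced:
  assumes "r \<in> carrier R" "m \<in> carrier M" "n \<in> carrier N"
  shows "pt (r \<odot>\<^bsub>M\<^esub> m) n = pt m (r \<odot>\<^bsub>N\<^esub> n)"
  unfolding pure_tensor_def
proof (rule coset_eq)
  show "frag_of (r \<odot>\<^bsub>M\<^esub> m, n) - frag_of (m, r \<odot>\<^bsub>N\<^esub> n) \<in> ker"
    by (rule relator_mem) (use assms in \<open>auto simp: tensor_relators_def\<close>)
qed (use assms in auto)

lemma pure_zero_left:
  assumes "n \<in> carrier N" shows "pt \<zero>\<^bsub>M\<^esub> n = \<one>\<^bsub>T\<^esub>"
proof -
  have "pt \<zero>\<^bsub>M\<^esub> n \<otimes>\<^bsub>T\<^esub> pt \<zero>\<^bsub>M\<^esub> n = pt \<zero>\<^bsub>M\<^esub> n"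
    using pure_add_left[of "\<zero>\<^bsub>M\<^esub>" "\<zero>\<^bsub>M\<^esub>" n] assms by simp
  then show ?thesis using T.l_cancel_one pure_closed assms by blast
qed

text \<open>Inverses of pure tensors are pure, so every tensor is a product of pure ones and
  induction on tensors needs no case for inverses.\<close>

lemma pure_uminus_left:
  assumes "m \<in> carrier M" "n \<in> carrier N" shows "pt (\<ominus>\<^bsub>M\<^esub> m) n = inv\<^bsub>T\<^esub> (pt m n)"
proof (rule T.inv_equality[symmetric])
  show "pt (\<ominus>\<^bsub>M\<^esub> m) n \<otimes>\<^bsub>T\<^esub> pt m n = \<one>\<^bsub>T\<^esub>"
    using pure_add_left[of "\<ominus>\<^bsub>M\<^esub> m" m n] assms by (simp add: M.l_neg pure_zero_left)
qed (use assms in auto)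

lemma pure_induct [consumes 1, case_names one pure mult]:
  assumes t: "t \<in> carrier T" and one: "P \<one>\<^bsub>T\<^esub>"
    and pure: "\<And>m n. m \<in> carrier M \<Longrightarrow> n \<in> carrier N \<Longrightarrow> P (pt m n)"
    and mult: "\<And>s t. s \<in> carrier T \<Longrightarrow> t \<in> carrier T \<Longrightarrow> P s \<Longrightarrow> P t \<Longrightarrow> P (s \<otimes>\<^bsub>T\<^esub> t)"
  shows "P t"
proof -
  let ?q = "\<lambda>c. ker #>\<^bsub>FG\<^esub> c"
  interpret q: group_hom FG T ?q
    using coset_hom by unfold_locales
  have neg: "?q (- c) = inv\<^bsub>T\<^esub> (?q c)" if "c \<in> carrier FG" for c
    using q.hom_inv[OF that] that by simp
  \<comment> \<open>Induction on the free abelian group proceeds by differences; proving the claim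
    for \<open>c\<close> and \<open>- c\<close> together turns them into products.\<close>
  have "P (?q c) \<and> P (?q (- c))" if "Poly_Mapping.keys c \<subseteq> carrier M \<times> carrier N" for c
    using that
  proof (induction c rule: free_Abelian_group_induct[consumes 1, case_names zero diff base])
    case zero
    then show ?case using one q.hom_one by simp
  next
    case (diff x y)
    have "?q (x - y) = ?q x \<otimes>\<^bsub>T\<^esub> ?q (- y)" "?q (- (x - y)) = ?q y \<otimes>\<^bsub>T\<^esub> ?q (- x)"
      using q.hom_mult[of x "- y"] q.hom_mult[of y "- x"] diff by simp_all
    then show ?case using diff q.hom_closed by (auto intro!: mult)
  next
    case (base a)
    obtain m n where a: "a = (m, n)" "m \<in> carrier M" "n \<in> carrier N" using base by auto
    have "?q (- frag_of a) = pt (\<ominus>\<^bsub>M\<^esub> m) n"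
      using a neg[of "frag_of a"] pure_uminus_left[of m n] by (simp add: pure_tensor_def)
    then show ?case using a pure[of m n] pure[of "\<ominus>\<^bsub>M\<^esub> m" n] by (simp add: pure_tensor_def)
  qed
  moreover obtain c where "c \<in> carrier FG" "t = ?q c"
    using t by (auto simp: tensor_product_def carrier_FactGroup)
  ultimately show ?thesis by simp
qed

lemma hom_eq_on_pure:
  assumes "comm_group A" "g \<in> hom T A" "h \<in> hom T A"
    and "\<And>m n. m \<in> carrier M \<Longrightarrow> n \<in> carrier N \<Longrightarrow> g (pt m n) = h (pt m n)"
    and "t \<in> carrier T"
  shows "g t = h t"
  using assms(5)
proof (induction t rule: pure_induct)
  case one
  then show ?case
    using hom_one[OF assms(2)] hom_one[OF assms(3)] assms(1) T.group_axioms comm_group.axioms(2) by metis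
next
  case (mult s t)
  then show ?case using hom_mult[OF assms(2)] hom_mult[OF assms(3)] by metis
qed (use assms(4) in auto)

text \<open>Universal property: \<open>f\<close> extends from the generators to the free abelian
  group; balancedness makes every relator trivial, so the extension factors through the quotient by
  \<open>tensor_kernel\<close>.\<close>

lemma lift_exists:
  assumes A: "comm_group A" and f: "balanced_map R M N A f"
  shows "\<exists>h \<in> hom T A. \<forall>m \<in> carrier M. \<forall>n \<in> carrier N. h (pt m n) = f m n"
proof -
  interpret A: comm_group A by (rule A)
  obtain h0 where h0: "h0 \<in> hom FG A"
    "\<And>x. x \<in> carrier M \<times> carrier N \<Longrightarrow> h0 (frag_of x) = case_prod f x"
    by (rule A.free_Abelian_group_universal[of "case_prod f" "carrier M \<times> carrier N"])
      (use f in \<open>auto simp: balanced_map_def\<close>)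
  interpret h0: group_hom FG A h0
    using h0(1) by unfold_locales
  have h0f: "h0 (frag_of (m, n)) = f m n" if "m \<in> carrier M" "n \<in> carrier N" for m n
    using h0(2) that by simp
  have diff: "h0 (x - y) = h0 x \<otimes>\<^bsub>A\<^esub> inv\<^bsub>A\<^esub> (h0 y)" if "x \<in> carrier FG" "y \<in> carrier FG" for x y
    using h0.hom_mult[of x "- y"] h0.hom_inv[of y] that by simp
  have diff_closed: "x - y \<in> carrier FG" if "x \<in> carrier FG" "y \<in> carrier FG" for x y
    using FG.m_closed[of x "- y"] that by simp
  have fc: "f m n \<in> carrier A" if "m \<in> carrier M" "n \<in> carrier N" for m n
    using f that by (auto simp: balanced_map_def)
  have "h0 x = \<one>\<^bsub>A\<^esub>" if x: "x \<in> tensor_relators R M N" for x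
  proof -
    consider m m' n where "x = frag_of (m \<oplus>\<^bsub>M\<^esub> m', n) - frag_of (m, n) - frag_of (m', n)"
        "m \<in> carrier M" "m' \<in> carrier M" "n \<in> carrier N"
      | m n n' where "x = frag_of (m, n \<oplus>\<^bsub>N\<^esub> n') - frag_of (m, n) - frag_of (m, n')"
        "m \<in> carrier M" "n \<in> carrier N" "n' \<in> carrier N"
      | r m n where "x = frag_of (r \<odot>\<^bsub>M\<^esub> m, n) - frag_of (m, r \<odot>\<^bsub>N\<^esub> n)"
        "r \<in> carrier R" "m \<in> carrier M" "n \<in> carrier N"
      using x unfolding tensor_relators_def by blast
    then show ?thesis
    proof cases
      case 1
      then have "f (m \<oplus>\<^bsub>M\<^esub> m') n = f m n \<otimes>\<^bsub>A\<^esub> f m' n"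
        using f by (simp add: balanced_map_def)
      then show ?thesis
        using 1 fc by (simp add: diff diff_closed h0f A.m_comm[of "f m n"] A.m_assoc
            del: carrier_free_Abelian_group_iff)
    next
      case 2
      then have "f m (n \<oplus>\<^bsub>N\<^esub> n') = f m n \<otimes>\<^bsub>A\<^esub> f m n'"
        using f by (simp add: balanced_map_def)
      then show ?thesis
        using 2 fc by (simp add: diff diff_closed h0f A.m_comm[of "f m n"] A.m_assoc
            del: carrier_free_Abelian_group_iff)
    next
      case 3
      then have "f (r \<odot>\<^bsub>M\<^esub> m) n = f m (r \<odot>\<^bsub>N\<^esub> n)"
        using f by (simp add: balanced_map_def)
      then show ?thesis
        using 3 fc by (simp add: diff h0f)
    qed
  qed
  then have "tensor_relators R M N \<subseteq> kernel FG A h0"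
    using relators_carrier by (auto simp: kernel_def simp del: carrier_free_Abelian_group_iff)
  then have ker: "ker \<subseteq> kernel FG A h0"
    unfolding tensor_kernel_def by (intro FG.generate_subgroup_incl h0.subgroup_kernel)
  obtain g where "g \<in> hom (FG Mod ker) A" "\<And>x. x \<in> carrier FG \<Longrightarrow> g (ker #>\<^bsub>FG\<^esub> x) = h0 x"
    using h0.FactGroup_universal_kernel[OF ker_normal ker] by blast
  then show ?thesis
    unfolding pure_tensor_def tensor_product_def using h0f by (intro bexI[of _ g]) auto
qed

text \<open>Homomorphisms are determined on the carrier by their values on pure tensors, and
  extensionality fixes them outside it. Together with existence this makes the definite description
  in \<open>tensor_lift\<close> denote.\<close>

lemma lift:
  assumes A: "comm_group A" and f: "balanced_map R M N A f"
  shows lift_hom: "tensor_lift R M N A f \<in> hom T A"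
    and lift_pure: "m \<in> carrier M \<Longrightarrow> n \<in> carrier N \<Longrightarrow> tensor_lift R M N A f (pt m n) = f m n"
proof -
  let ?P = "\<lambda>h. h \<in> hom T A \<and> h \<in> extensional (carrier T) \<and>
    (\<forall>m \<in> carrier M. \<forall>n \<in> carrier N. h (pt m n) = f m n)"
  obtain g where g: "g \<in> hom T A" "\<forall>m \<in> carrier M. \<forall>n \<in> carrier N. g (pt m n) = f m n"
    using lift_exists[OF assms] by blast
  have "?P (restrict g (carrier T))"
    using g by (auto simp: hom_def pure_closed)
  moreover have "h = h'" if "?P h" "?P h'" for h h'
  proof (rule extensionalityI)
    show "h \<in> extensional (carrier T)" "h' \<in> extensional (carrier T)" using that by auto
    show "h t = h' t" if "t \<in> carrier T" for t
      by (rule hom_eq_on_pure[OF A _ _ _ that]) (use \<open>?P h\<close> \<open>?P h'\<close> in auto)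
  qed
  ultimately have "\<exists>!h. ?P h" by blast
  from theI'[OF this] have "?P (tensor_lift R M N A f)" unfolding tensor_lift_def .
  then show "tensor_lift R M N A f \<in> hom T A"
    "m \<in> carrier M \<Longrightarrow> n \<in> carrier N \<Longrightarrow> tensor_lift R M N A f (pt m n) = f m n"
    by auto
qed

text \<open>The tensor \<open>\<Sum> h i \<otimes> z i\<close>, written as a product because the
  tensor product is a multiplicative record. It is the normal form in which later computations take
  place.\<close>

primrec tsum :: "(nat \<Rightarrow> 'n) \<Rightarrow> (nat \<Rightarrow> 'm) \<Rightarrow> nat \<Rightarrow> ('m \<times> 'n \<Rightarrow>\<^sub>0 int) set"
  where "tsum z h 0 = \<one>\<^bsub>T\<^esub>"
  | "tsum z h (Suc k) = tsum z h k \<otimes>\<^bsub>T\<^esub> pt (h k) (z k)"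

lemma tsum_closed:
  "(\<And>i. i < k \<Longrightarrow> h i \<in> carrier M) \<Longrightarrow> (\<And>i. i < k \<Longrightarrow> z i \<in> carrier N) \<Longrightarrow> tsum z h k \<in> carrier T"
  by (induction k) auto

lemma tsum_cong: "(\<And>i. i < k \<Longrightarrow> h i = h' i) \<Longrightarrow> tsum z h k = tsum z h' k"
  by (induction k) auto

lemma tsum_zero: "(\<And>i. i < k \<Longrightarrow> z i \<in> carrier N) \<Longrightarrow> tsum z (\<lambda>_. \<zero>\<^bsub>M\<^esub>) k = \<one>\<^bsub>T\<^esub>"
  by (induction k) (auto simp: pure_zero_left)

lemma tsum_add:
  assumes "\<And>i. i < k \<Longrightarrow> h i \<in> carrier M" "\<And>i. i < k \<Longrightarrow> h' i \<in> carrier M" "\<And>i. i < k \<Longrightarrow> z i \<in> carrier N"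
  shows "tsum z (\<lambda>i. h i \<oplus>\<^bsub>M\<^esub> h' i) k = tsum z h k \<otimes>\<^bsub>T\<^esub> tsum z h' k"
  using assms
proof (induction k)
  case (Suc k)
  have c: "tsum z h k \<in> carrier T" "tsum z h' k \<in> carrier T" "pt (h k) (z k) \<in> carrier T" "pt (h' k) (z k) \<in> carrier T"
    using Suc.prems by (auto intro: tsum_closed)
  have "tsum z (\<lambda>i. h i \<oplus>\<^bsub>M\<^esub> h' i) k = tsum z h k \<otimes>\<^bsub>T\<^esub> tsum z h' k"
    using Suc by auto
  then show ?case using c Suc.prems by (simp add: pure_add_left T.m_ac)
qed simp

text \<open>Bridge from the multiplicative notation of the tensor product to sums in the target,
  which will be the field or the left factor.\<close>

lemma hom_tsum_add_monoid:
  fixes A :: "('x, 'y) ring_scheme"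
  assumes "abelian_group A" "g \<in> hom T (add_monoid A)"
    and "\<And>i. i < k \<Longrightarrow> h i \<in> carrier M" "\<And>i. i < k \<Longrightarrow> z i \<in> carrier N"
  shows "g (tsum z h k) = finsum A (\<lambda>i. g (pt (h i) (z i))) {..<k}"
  using assms(3,4)
proof (induction k)
  case 0
  interpret A: abelian_group A by fact
  show ?case using hom_one[OF assms(2) T.group_axioms A.a_group] by simp
next
  case (Suc k)
  interpret A: abelian_group A by fact
  have cl: "g (pt (h i) (z i)) \<in> carrier A" if "i < Suc k" for i
    using hom_in_carrier[OF assms(2) pure_closed] Suc.prems that by auto
  have "g (tsum z h (Suc k)) = g (tsum z h k) \<oplus>\<^bsub>A\<^esub> g (pt (h k) (z k))"
    using hom_mult[OF assms(2), of "tsum z h k" "pt (h k) (z k)"] Suc.prems tsum_closed[of k h z] by auto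
  also have "\<dots> = finsum A (\<lambda>i. g (pt (h i) (z i))) {..<Suc k}"
    using Suc cl by (simp add: lessThan_Suc A.finsum_insert A.a_comm Pi_def A.finsum_closed)
  finally show ?case .
qed

end

lemma abelian_group_top_ring: "abelian_group (top_ring :: 'a::field ring)"
  using ring_from_type_algebra ring.is_abelian_group by blast

lemma comm_group_top_ring: "comm_group (add_monoid (top_ring :: 'a::field ring))"
  using abelian_group.a_comm_group[OF abelian_group_top_ring] .

lemma finsum_top_ring: "finite I \<Longrightarrow> finsum (top_ring :: 'a::field ring) f I = sum f I"
proof (induction I rule: finite_induct)
  interpret abelian_group "top_ring :: 'a ring" by (rule abelian_group_top_ring)
  case empty
  then show ?case by simp
next
  interpret abelian_group "top_ring :: 'a ring" by (rule abelian_group_top_ring)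
  case (insert i I)
  then show ?case by simp
qed

lemma mult_module_simps [simp]:
  "carrier (mult_module M) = M" "x \<oplus>\<^bsub>mult_module M\<^esub> y = x + y" "\<zero>\<^bsub>mult_module M\<^esub> = 0"
  "r \<odot>\<^bsub>mult_module M\<^esub> x = r * x"
  by (simp_all add: mult_module_def)

lemma (in field_subring) module_mult_module:
  assumes "0 \<in> M" "\<And>x y. x \<in> M \<Longrightarrow> y \<in> M \<Longrightarrow> x + y \<in> M" "\<And>r x. r \<in> R \<Longrightarrow> x \<in> M \<Longrightarrow> r * x \<in> M"
  shows "module (subring_of R) (mult_module M)"
proof (rule moduleI)
  show "abelian_group (mult_module M)"
  proof (rule abelian_groupI)
    show "\<exists>y\<in>carrier (mult_module M). y \<oplus>\<^bsub>mult_module M\<^esub> x = \<zero>\<^bsub>mult_module M\<^esub>" if "x \<in> carrier (mult_module M)" for x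
      using assms(3)[OF uminus_mem[OF one_mem], of x] that by (auto intro!: bexI[of _ "- x"])
  qed (use assms in \<open>auto simp: algebra_simps\<close>)
qed (use assms cring_subring_of in \<open>auto simp: algebra_simps\<close>)

lemma (in tensor_pair) lift_tsum:
  fixes f :: "'m \<Rightarrow> 'n \<Rightarrow> 'a::field"
  assumes f: "balanced_map R M N (add_monoid top_ring) f"
    and "\<And>i. i < k \<Longrightarrow> h i \<in> carrier M" "\<And>i. i < k \<Longrightarrow> z i \<in> carrier N"
  shows "tensor_lift R M N (add_monoid top_ring) f (tsum z h k) = (\<Sum>i<k. f (h i) (z i))"
proof -
  have "tensor_lift R M N (add_monoid top_ring) f (tsum z h k)
      = finsum top_ring (\<lambda>i. tensor_lift R M N (add_monoid top_ring) f (pt (h i) (z i))) {..<k}"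
    by (rule hom_tsum_add_monoid[OF abelian_group_top_ring lift_hom[OF comm_group_top_ring f]]) (use assms in auto)
  also have "\<dots> = (\<Sum>i<k. f (h i) (z i))"
    using lift_pure[OF comm_group_top_ring f] assms(2,3) by (simp add: finsum_top_ring)
  finally show ?thesis .
qed

lemma balanced_mult:
  "balanced_map (subring_of R) (mult_module M) (mult_module N) (add_monoid top_ring) (*)"
  by (simp add: balanced_map_def distrib_left distrib_right mult_ac)

text \<open>Tensoring with a free module gives coordinates in the left factor. There will be four
  instances with the same \<open>z\<close> and \<open>d\<close>: over \<open>K\<close> with
  \<open>F\<close> on the right and \<open>E\<close> or \<open>H1\<close> on the left, over
  \<open>R\<close> with the integers of \<open>F\<close> on the right and the integers of
  \<open>E\<close> or the associated order on the left.\<close>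

locale free_tensor =
  fixes R N :: "'a::field set" and M :: "('a, 'm) module" and z :: "nat \<Rightarrow> 'a" and d :: nat
  assumes left_module: "module (subring_of R) M"
    and right_module: "module (subring_of R) (mult_module N)"
    and basis: "module_basis R N z d"
begin

sublocale tensor_pair "subring_of R" M "mult_module N"
  by (rule tensor_pair.intro[OF left_module right_module])

sublocale field_subring R
  by (rule field_subring_if_cring) (rule M.is_cring)

lemma basis_span: "N = {\<Sum>i<d. c i * z i | c. \<forall>i<d. c i \<in> R}"
  using basis by (simp add: module_basis_def)

lemma basis_spanE:
  assumes "n \<in> N" obtains c where "\<forall>i<d. c i \<in> R" "n = (\<Sum>i<d. c i * z i)"
  using assms by (subst (asm) basis_span) blast

lemma basis_indep: "\<forall>i<d. c i \<in> R \<Longrightarrow> (\<Sum>i<d. c i * z i) = 0 \<Longrightarrow> i < d \<Longrightarrow> c i = 0"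
  using basis by (simp add: module_basis_def)

lemma basis_mem: "i < d \<Longrightarrow> z i \<in> N"
  unfolding basis_span
  by (rule CollectI, rule exI[of _ "\<lambda>j. if j = i then 1 else 0"])
    (auto simp: zero_mem one_mem if_distrib[of "\<lambda>x. x * _"] cong: if_cong)

text \<open>On \<open>N\<close> and for \<open>j < d\<close> the choice is unambiguous by linear
  independence, which is the content of \<open>coord_eq\<close>.\<close>

definition coord :: "nat \<Rightarrow> 'a \<Rightarrow> 'a"
  where "coord j n = (SOME c. (\<forall>i<d. c i \<in> R) \<and> n = (\<Sum>i<d. c i * z i)) j"

lemma coord_eq:
  assumes "\<forall>i<d. c i \<in> R" "n = (\<Sum>i<d. c i * z i)" "j < d"
  shows "coord j n = c j"
proof -
  let ?P = "\<lambda>c. (\<forall>i<d. c i \<in> R) \<and> n = (\<Sum>i<d. c i * z i)"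
  define c' where "c' = Eps ?P"
  have c': "?P c'" unfolding c'_def by (rule someI[of ?P c]) (use assms in auto)
  have "(\<Sum>i<d. (c' i - c i) * z i) = 0"
    using c' assms by (simp add: left_diff_distrib sum_subtractf)
  moreover have "\<forall>i<d. c' i - c i \<in> R" using c' assms by (auto intro: diff_mem)
  ultimately have "c' j - c j = 0"
    using basis_indep[of "\<lambda>i. c' i - c i" j] assms(3) by simp
  then show ?thesis by (simp add: coord_def c'_def)
qed

lemma coord_mem:
  assumes "n \<in> N" "j < d" shows "coord j n \<in> R"
proof -
  obtain c where "\<forall>i<d. c i \<in> R" "n = (\<Sum>i<d. c i * z i)" using basis_spanE[OF assms(1)] .
  then show ?thesis using coord_eq[of c n j] assms(2) by simp
qed

lemma coord_add:
  assumes "n \<in> N" "n' \<in> N" "j < d" shows "coord j (n + n') = coord j n + coord j n'"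
proof -
  obtain c where c: "\<forall>i<d. c i \<in> R" "n = (\<Sum>i<d. c i * z i)" using basis_spanE[OF assms(1)] .
  obtain c' where c': "\<forall>i<d. c' i \<in> R" "n' = (\<Sum>i<d. c' i * z i)" using basis_spanE[OF assms(2)] .
  have "coord j (n + n') = c j + c' j"
    using c c' assms(3) by (intro coord_eq[of "\<lambda>i. c i + c' i"]) (auto simp: add_mem distrib_right sum.distrib)
  then show ?thesis using coord_eq[OF c assms(3)] coord_eq[OF c' assms(3)] by simp
qed

lemma coord_scale:
  assumes "r \<in> R" "n \<in> N" "j < d" shows "coord j (r * n) = r * coord j n"
proof -
  obtain c where c: "\<forall>i<d. c i \<in> R" "n = (\<Sum>i<d. c i * z i)" using basis_spanE[OF assms(2)] .
  have "coord j (r * n) = r * c j"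
    using c assms by (intro coord_eq[of "\<lambda>i. r * c i"]) (auto simp: mult_mem mult.assoc sum_distrib_left)
  then show ?thesis using coord_eq[OF c assms(3)] by simp
qed

lemma coord_basis:
  assumes "i < d" "j < d" shows "coord j (z i) = (if i = j then 1 else 0)"
  using assms coord_eq[of "\<lambda>k. if k = i then 1 else 0" "z i" j]
  by (auto simp: zero_mem one_mem if_distrib[of "\<lambda>x. x * _"] cong: if_cong)

text \<open>Balancedness moves each scalar \<open>c i\<close> from the right factor to the left. The
  bound \<open>k\<close> permits induction over partial sums; \<open>k = d\<close> is the case of
  interest.\<close>

lemma pure_eq_tsum:
  assumes m: "m \<in> carrier M" and c: "\<And>i. i < k \<Longrightarrow> c i \<in> R" and k: "k \<le> d"
  shows "pt m (\<Sum>i<k. c i * z i) = tsum z (\<lambda>i. c i \<odot>\<^bsub>M\<^esub> m) k"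
  using c k
proof (induction k)
  case 0
  \<comment> \<open>The tensor of \<open>m\<close> with 0 is trivial because the scalar 0 can be
    moved over to \<open>m\<close>.\<close>
  have "pt m 0 = pt m (0 \<odot>\<^bsub>mult_module N\<^esub> 0)" by simp
  also have "\<dots> = pt (0 \<odot>\<^bsub>M\<^esub> m) 0"
    using pure_balanced[of 0 m 0] m zero_mem N.zero_closed by simp
  also have "0 \<odot>\<^bsub>M\<^esub> m = \<zero>\<^bsub>M\<^esub>" using M.smult_l_null[OF m] by simp
  finally show ?case using pure_zero_left[of 0] N.zero_closed by simp
next
  case (Suc k)
  have s: "(\<Sum>i<k. c i * z i) \<in> N"
    using Suc.prems basis_mem N.smult_closed N.zero_closed N.a_closed
    by (induction k) auto
  have "pt m (\<Sum>i<Suc k. c i * z i) = pt m (\<Sum>i<k. c i * z i) \<otimes>\<^bsub>T\<^esub> pt m (c k * z k)"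
    using pure_add_right[of m "\<Sum>i<k. c i * z i" "c k * z k"] m s Suc.prems basis_mem[of k] N.smult_closed[of "c k" "z k"]
    by simp
  also have "pt m (c k * z k) = pt (c k \<odot>\<^bsub>M\<^esub> m) (z k)"
    using pure_balanced[of "c k" m "z k"] Suc.prems basis_mem[of k] m by simp
  finally show ?case using Suc by simp
qed

lemma tsum_exists:
  assumes "t \<in> carrier T"
  obtains h where "\<And>i. i < d \<Longrightarrow> h i \<in> carrier M" "t = tsum z h d"
proof -
  have "\<exists>h. (\<forall>i<d. h i \<in> carrier M) \<and> t = tsum z h d"
    using assms
  proof (induction t rule: pure_induct)
    case one
    then show ?case using tsum_zero[of d z] basis_mem by (intro exI[of _ "\<lambda>_. \<zero>\<^bsub>M\<^esub>"]) auto
  next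
    case (pure m n)
    then have "n \<in> N" by simp
    then obtain c where c: "\<forall>i<d. c i \<in> R" "n = (\<Sum>i<d. c i * z i)" by (rule basis_spanE)
    then show ?case using pure pure_eq_tsum[of m d c] by (intro exI[of _ "\<lambda>i. c i \<odot>\<^bsub>M\<^esub> m"]) auto
  next
    case (mult s t)
    then obtain h h' where "\<forall>i<d. h i \<in> carrier M" "s = tsum z h d" "\<forall>i<d. h' i \<in> carrier M" "t = tsum z h' d"
      by blast
    then show ?case using tsum_add[of d h h' z] basis_mem by (intro exI[of _ "\<lambda>i. h i \<oplus>\<^bsub>M\<^esub> h' i"]) auto
  qed
  then show thesis using that by blast
qed

text \<open>The balanced map that scales \<open>m\<close> by \<open>coord j n\<close> induces a
  homomorphism into \<open>M\<close>, which reads off the \<open>j\<close>-th coefficient of a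
  normal form.\<close>

lemma tsum_inj:
  assumes h: "\<And>i. i < d \<Longrightarrow> h i \<in> carrier M" and h': "\<And>i. i < d \<Longrightarrow> h' i \<in> carrier M"
    and eq: "tsum z h d = tsum z h' d" and j: "j < d"
  shows "h j = h' j"
proof -
  define f where "f m n = coord j n \<odot>\<^bsub>M\<^esub> m" for m n
  have cg: "comm_group (add_monoid M)" by (rule M.a_comm_group)
  have bal: "balanced_map (subring_of R) M (mult_module N) (add_monoid M) f"
    unfolding balanced_map_def f_def
    using coord_mem[OF _ j] coord_add[OF _ _ j] coord_scale[OF _ _ j]
      M.smult_l_distr M.smult_r_distr M.smult_assoc1 M.smult_closed
    by (simp flip: M.smult_assoc1 add: mult.commute)
  obtain g where g: "g \<in> hom T (add_monoid M)" "\<And>m n. m \<in> carrier M \<Longrightarrow> n \<in> N \<Longrightarrow> g (pt m n) = f m n"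
    using lift_exists[OF cg bal] by auto
  have *: "g (tsum z h d) = h j" if h: "\<And>i. i < d \<Longrightarrow> h i \<in> carrier M" for h
  proof -
    have "g (pt (h i) (z i)) = (if j = i then h i else \<zero>\<^bsub>M\<^esub>)" if "i < d" for i
      using g(2)[of "h i" "z i"] h that basis_mem j M.smult_l_null M.smult_one
      by (auto simp: f_def coord_basis)
    then have "g (tsum z h d) = finsum M (\<lambda>i. if j = i then h i else \<zero>\<^bsub>M\<^esub>) {..<d}"
      using hom_tsum_add_monoid[OF M.abelian_group_axioms g(1), of d h z] h basis_mem
      by (auto intro!: M.finsum_cong')
    also have "\<dots> = h j" using h j by (intro M.add.finprod_singleton) auto
    finally show ?thesis .
  qed
  show ?thesis using *[of h] *[of h'] h h' eq by simp
qed

end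


section \<open>Galois theory\<close>

lemma galois_group_carrier_iff:
  "\<sigma> \<in> carrier (galois_group K) \<longleftrightarrow>
    bij \<sigma> \<and> (\<forall>x y. \<sigma> (x + y) = \<sigma> x + \<sigma> y) \<and> (\<forall>x y. \<sigma> (x * y) = \<sigma> x * \<sigma> y) \<and> \<sigma> 1 = 1 \<and> (\<forall>k\<in>K. \<sigma> k = k)"
  by (auto simp: galois_group_def ring_iso_def Ring.ring_hom_def)

lemma galois_group_simps [simp]:
  "\<sigma> \<otimes>\<^bsub>galois_group K\<^esub> \<tau> = \<sigma> \<circ> \<tau>" "\<one>\<^bsub>galois_group K\<^esub> = id"
  by (simp_all add: galois_group_def)

locale field_endo =
  fixes \<sigma> :: "'a::field \<Rightarrow> 'a"
  assumes add: "\<sigma> (x + y) = \<sigma> x + \<sigma> y" and mult: "\<sigma> (x * y) = \<sigma> x * \<sigma> y" and one: "\<sigma> 1 = 1"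
begin

lemma zero: "\<sigma> 0 = 0" using add[of 0 0] by (metis add_cancel_right_right)
lemma uminus: "\<sigma> (- x) = - \<sigma> x" using add[of x "- x"] zero by (simp add: eq_neg_iff_add_eq_0 add.commute)
lemma diff: "\<sigma> (x - y) = \<sigma> x - \<sigma> y" using add[of x "- y"] uminus by simp
lemma sum: "\<sigma> (sum f I) = (\<Sum>i\<in>I. \<sigma> (f i))" by (induction I rule: infinite_finite_induct) (auto simp: zero add)
lemma power: "\<sigma> (x ^ n) = \<sigma> x ^ n" by (induction n) (auto simp: one mult)
lemma inverse: "\<sigma> (inverse x) = inverse (\<sigma> x)"
proof (cases "x = 0")
  case False
  then have "\<sigma> x * \<sigma> (inverse x) = 1" using mult[of x "inverse x"] one by simp
  then show ?thesis by (metis inverse_unique)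
qed (simp add: zero)

end

lemma field_endo_galois: "\<sigma> \<in> carrier (galois_group K) \<Longrightarrow> field_endo \<sigma>"
  by unfold_locales (auto simp: galois_group_carrier_iff)

lemma galois_group_fixes: "\<sigma> \<in> carrier (galois_group K) \<Longrightarrow> k \<in> K \<Longrightarrow> \<sigma> k = k"
  by (simp add: galois_group_carrier_iff)

text \<open>The separating element of Chase, Harrison and Rosenberg: tensors in \<open>F \<otimes> F\<close> act on \<open>S\<close> as
  functions closed under products, so the indicator of \<open>id\<close> is a product of the functions
  \<open>\<tau> \<mapsto> (\<tau> a - \<sigma> a) / (a - \<sigma> a)\<close>.\<close>

lemma separating_pairs:
  assumes "finite S" "\<And>\<sigma>. \<sigma> \<in> S \<Longrightarrow> field_endo \<sigma>"
    and F: "field_subring F" "\<And>x. x \<in> F \<Longrightarrow> inverse x \<in> F"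
    and "\<And>\<sigma> x. \<sigma> \<in> S \<Longrightarrow> x \<in> F \<Longrightarrow> \<sigma> x \<in> F"
    and "\<And>\<sigma>. \<sigma> \<in> S \<Longrightarrow> \<sigma> \<noteq> id \<Longrightarrow> \<exists>a\<in>F. \<sigma> a \<noteq> a"
  shows "\<exists>ps. set ps \<subseteq> F \<times> F \<and> (\<Sum>(c, f)\<leftarrow>ps. c * f) = 1 \<and>
    (\<forall>\<sigma>\<in>S - {id}. (\<Sum>(c, f)\<leftarrow>ps. c * \<sigma> f) = 0)"
  using assms(1,2,5,6)
proof (induction S rule: finite_induct)
  case empty
  show ?case using field_subring.one_mem[OF F(1)] by (intro exI[of _ "[(1, 1)]"]) auto
next
  case (insert \<sigma> S)
  interpret F: field_subring F by (rule F)
  have IH: "\<exists>ps. set ps \<subseteq> F \<times> F \<and> (\<Sum>(c, f)\<leftarrow>ps. c * f) = 1 \<and>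
    (\<forall>\<sigma>\<in>S - {id}. (\<Sum>(c, f)\<leftarrow>ps. c * \<sigma> f) = 0)"
    by (rule insert.IH) (use insert.prems in auto)
  then obtain ps where ps: "set ps \<subseteq> F \<times> F" "(\<Sum>(c, f)\<leftarrow>ps. c * f) = 1"
    "\<And>\<tau>. \<tau> \<in> S \<Longrightarrow> \<tau> \<noteq> id \<Longrightarrow> (\<Sum>(c, f)\<leftarrow>ps. c * \<tau> f) = 0"
    by blast
  show ?case
  proof (cases "\<sigma> = id")
    case True
    then have "insert \<sigma> S - {id} = S - {id}" by auto
    then show ?thesis using IH by (simp only:)
  next
    case False
    then obtain a where a: "a \<in> F" "\<sigma> a \<noteq> a" using insert.prems(3)[OF insertI1] by blast
    have sa: "\<sigma> a \<in> F" using insert.prems(2)[of \<sigma>] a by auto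
    define u where "u = inverse (a - \<sigma> a)"
    have u: "u \<in> F" "u * (a - \<sigma> a) = 1" using a sa F by (auto simp: u_def F.diff_mem)
    \<comment> \<open>This multiplies the tensor given by \<open>ps\<close> by \<open>u\<close>
      times \<open>1 \<otimes> a - \<sigma> a \<otimes> 1\<close>. Its value at
      \<open>\<tau>\<close> gains the factor \<open>u * (\<tau> a - \<sigma> a)\<close>, which is 1
      at \<open>id\<close> and 0 at \<open>\<sigma>\<close>.\<close>
    define qs where "qs = map (\<lambda>(c, f). (c * u, a * f)) ps @ map (\<lambda>(c, f). (- c * u * \<sigma> a, f)) ps"
    have val: "(\<Sum>(c, f)\<leftarrow>qs. c * \<tau> f) = u * (\<tau> a - \<sigma> a) * (\<Sum>(c, f)\<leftarrow>ps. c * \<tau> f)"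
      if "\<And>x y. \<tau> (x * y) = \<tau> x * \<tau> y" for \<tau>
      unfolding qs_def by (induction ps) (auto simp: that algebra_simps split: prod.splits)
    have "set qs \<subseteq> F \<times> F"
      using ps(1) u a sa unfolding qs_def by (auto intro!: F.mult_mem F.uminus_mem simp flip: mult_minus_left)
    moreover have "(\<Sum>(c, f)\<leftarrow>qs. c * f) = 1"
      using val[of "\<lambda>x. x"] ps(2) u(2) by simp
    moreover have "(\<Sum>(c, f)\<leftarrow>qs. c * \<tau> f) = 0" if \<tau>: "\<tau> \<in> insert \<sigma> S - {id}" for \<tau>
    proof -
      have "(\<Sum>(c, f)\<leftarrow>qs. c * \<tau> f) = u * (\<tau> a - \<sigma> a) * (\<Sum>(c, f)\<leftarrow>ps. c * \<tau> f)"
        using val[of \<tau>] field_endo.mult[OF insert.prems(1)] \<tau> by simp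
      then show ?thesis using ps(3)[of \<tau>] \<tau> by (cases "\<tau> = \<sigma>") simp_all
    qed
    ultimately show ?thesis by (intro exI[of _ qs] conjI ballI)
  qed
qed

text \<open>Exchanging the sums puts the indicator of \<open>id\<close> in front of
  \<open>\<sigma> x\<close>, so \<open>x\<close> is recovered from the traces of its multiples
  \<open>f * x\<close>. This identity yields Artin's theorem, the decomposition of the compositum
  and the non-degeneracy of the trace form.\<close>

lemma separating_pairs_sum:
  assumes "finite S" "id \<in> S" "(\<Sum>(c, f)\<leftarrow>ps. c * f) = 1"
    and "\<forall>\<sigma>\<in>S - {id}. (\<Sum>(c, f)\<leftarrow>ps. c * \<sigma> f) = (0::'a::field)"
    and "\<And>\<sigma>. \<sigma> \<in> S \<Longrightarrow> field_endo \<sigma>"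
  shows "(\<Sum>(c, f)\<leftarrow>ps. c * (\<Sum>\<sigma>\<in>S. \<sigma> (f * x))) = x"
proof -
  have "(\<Sum>(c, f)\<leftarrow>ps. c * (\<Sum>\<sigma>\<in>S. \<sigma> (f * x))) = (\<Sum>\<sigma>\<in>S. \<sigma> x * (\<Sum>(c, f)\<leftarrow>ps. c * \<sigma> f))"
    by (induction ps)
      (auto simp: sum_distrib_left distrib_left sum.distrib field_endo.mult[OF assms(5)] mult_ac intro!: sum.cong)
  also have "\<dots> = (\<Sum>\<sigma>\<in>S. if \<sigma> = id then x else 0)"
    using assms(3,4) by (intro sum.cong) auto
  finally show ?thesis using assms(1,2) by simp
qed

lemma nat_pow_top_ring: "x [^]\<^bsub>top_ring\<^esub> (n::nat) = x ^ n"
  by (induction n) (auto simp: nat_pow_def mult.commute)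

text \<open>Polynomials over a ring record are coefficient lists with the leading coefficient in
  front, hence the reversal.\<close>

lemma eval_top_ring: "ring.eval top_ring p x = Polynomial.poly (Poly (rev p)) x"
proof (induction p)
  interpret ring top_ring by (rule ring_from_type_algebra)
  case Nil
  then show ?case by simp
next
  interpret ring top_ring by (rule ring_from_type_algebra)
  case (Cons a p)
  then show ?case by (simp add: Poly_snoc poly_monom nat_pow_top_ring)
qed

section \<open>Finite Galois extensions, traces and Artin's theorem\<close>

locale galois_ext =
  fixes K :: "'a::field set"
  assumes finite_galois: "finite_galois K" and group: "Group.group (galois_group K)"
begin

abbreviation "G \<equiv> carrier (galois_group K)"

sublocale G: Group.group "galois_group K" by (rule group)

lemma subfield: "subfield K top_ring" using finite_galois by (simp add: finite_galois_def)

sublocale K: field_subring K by (rule field_subring_if_subfield[OF subfield])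

lemma K_inverse: "x \<in> K \<Longrightarrow> inverse x \<in> K" by (rule field_inverse_mem[OF subfield])

lemma algebraic:
  obtains p where "p \<noteq> 0" "range (Polynomial.coeff p) \<subseteq> K" "Polynomial.poly p x = 0"
proof -
  interpret T: field "top_ring :: 'a ring" by (rule field_from_type_algebra)
  have "(T.algebraic over K) x"
    by (rule T.finite_dimension_imp_algebraic[OF subfield T.carrier_is_subring])
      (use finite_galois in \<open>auto simp: finite_galois_def\<close>)
  then obtain p where p: "p \<in> carrier (K [X]\<^bsub>top_ring\<^esub>)" "p \<noteq> []" "T.eval p x = \<zero>\<^bsub>top_ring\<^esub>"
    by (rule T.algebraicE[OF subfieldE(1)[OF subfield], rotated]) auto
  then have p': "set p \<subseteq> K" "hd p \<noteq> 0" by (auto simp: univ_poly_def polynomial_def)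
  define q where "q = Poly (rev p)"
  have "Polynomial.coeff q (length p - 1) = hd p"
    using p(2) by (simp add: q_def nth_default_def rev_nth hd_conv_nth)
  then have "q \<noteq> 0" using p' by auto
  moreover have "range (Polynomial.coeff q) \<subseteq> K"
    using p'(1) K.zero_mem by (auto simp: q_def nth_default_def rev_nth)
  moreover have "Polynomial.poly q x = 0" using p(3) by (simp add: q_def eval_top_ring)
  ultimately show thesis using that by blast
qed

text \<open>An automorphism over \<open>K\<close> is determined by its values on a finite spanning
  list \<open>Us\<close>, and each value is a root of a polynomial over \<open>K\<close> that
  annihilates the spanning element. Only finitely many lists of values remain.\<close>

lemma finite_G: "finite G"
proof -
  interpret T: field "top_ring :: 'a ring" by (rule field_from_type_algebra)
  obtain n where "T.dimension n K UNIV"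
    using finite_galois by (auto simp: finite_galois_def T.finite_dimension_def)
  then obtain Us where "T.Span K Us = UNIV"
    using T.exists_base[OF subfield] by blast
  then have "UNIV = {T.combine Ks Us | Ks. set Ks \<subseteq> K}"
    using T.Span_eq_combine_set[OF subfield, of Us] by (simp del: T.Span.simps)
  then have span: "\<exists>Ks. set Ks \<subseteq> K \<and> x = T.combine Ks Us" for x
    by blast
  have comb: "\<sigma> (T.combine Ks Us) = T.combine Ks (map \<sigma> Us)" if "\<sigma> \<in> G" "set Ks \<subseteq> K" for \<sigma> Ks Us
  proof -
    interpret field_endo \<sigma> using that by (rule_tac field_endo_galois)
    show ?thesis using that
      by (induction Ks Us rule: T.combine.induct) (auto simp: zero add mult galois_group_fixes)
  qed
  have inj: "inj_on (\<lambda>\<sigma>. map \<sigma> Us) G"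
  proof (rule inj_onI, rule ext)
    fix \<sigma> \<tau> x assume "\<sigma> \<in> G" "\<tau> \<in> G" "map \<sigma> Us = map \<tau> Us"
    then show "\<sigma> x = \<tau> x" using span[of x] comb by metis
  qed
  have "\<exists>p. p \<noteq> 0 \<and> range (Polynomial.coeff p) \<subseteq> K \<and> Polynomial.poly p x = 0" for x
    by (rule algebraic[of x]) blast
  then obtain p where p: "\<And>x. p x \<noteq> 0" "\<And>x. range (Polynomial.coeff (p x)) \<subseteq> K" "\<And>x. Polynomial.poly (p x) x = 0"
    by metis
  define Z where "Z = (\<Union>u\<in>set Us. {y. Polynomial.poly (p u) y = 0})"
  have "finite Z" unfolding Z_def using p(1) by (auto intro: poly_roots_finite)
  then have fin: "finite {xs. set xs \<subseteq> Z \<and> length xs = length Us}" by (rule finite_lists_length_eq)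
  have "map \<sigma> Us \<in> {xs. set xs \<subseteq> Z \<and> length xs = length Us}" if \<sigma>: "\<sigma> \<in> G" for \<sigma>
  proof -
    interpret field_endo \<sigma> using \<sigma> by (rule field_endo_galois)
    have "\<sigma> (Polynomial.coeff (p u) i) = Polynomial.coeff (p u) i" for u i
      using p(2)[of u] galois_group_fixes[OF \<sigma>] by blast
    then have "Polynomial.poly (p u) (\<sigma> u) = \<sigma> (Polynomial.poly (p u) u)" for u
      by (simp add: poly_altdef sum mult power)
    then show ?thesis by (auto simp: Z_def p(3) zero)
  qed
  then show ?thesis using fin inj by (meson finite_subset image_subsetI inj_on_finite)
qed

lemma subgroup_memD:
  assumes "subgroup S (galois_group K)"
  shows "id \<in> S" "\<sigma> \<in> S \<Longrightarrow> \<sigma> \<in> G" "\<sigma> \<in> S \<Longrightarrow> \<tau> \<in> S \<Longrightarrow> \<sigma> \<circ> \<tau> \<in> S"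
    "\<sigma> \<in> S \<Longrightarrow> \<exists>\<tau>\<in>S. \<sigma> \<circ> \<tau> = id \<and> \<tau> \<circ> \<sigma> = id"
proof -
  show "id \<in> S" "\<sigma> \<in> S \<Longrightarrow> \<sigma> \<in> G" "\<sigma> \<in> S \<Longrightarrow> \<tau> \<in> S \<Longrightarrow> \<sigma> \<circ> \<tau> \<in> S"
    using subgroup.one_closed[OF assms] subgroup.mem_carrier[OF assms, of \<sigma>] subgroup.m_closed[OF assms, of \<sigma> \<tau>] by auto
  show "\<exists>\<tau>\<in>S. \<sigma> \<circ> \<tau> = id \<and> \<tau> \<circ> \<sigma> = id" if "\<sigma> \<in> S"
    using subgroup.m_inv_closed[OF assms that] subgroup.mem_carrier[OF assms that]
      G.l_inv[of \<sigma>] G.r_inv[of \<sigma>] by auto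
qed

lemma subgroup_finite: "subgroup S (galois_group K) \<Longrightarrow> finite S"
  using finite_G subgroup.subset finite_subset by blast

text \<open>Left translation by \<open>\<rho>\<close> permutes \<open>S\<close>.\<close>

lemma trace_fixed:
  assumes S: "subgroup S (galois_group K)" and \<rho>: "\<rho> \<in> S"
  shows "\<rho> (\<Sum>\<sigma>\<in>S. \<sigma> x) = (\<Sum>\<sigma>\<in>S. \<sigma> x)"
proof -
  obtain \<rho>' where \<rho>': "\<rho>' \<in> S" "\<rho> \<circ> \<rho>' = id" "\<rho>' \<circ> \<rho> = id" using subgroup_memD(4)[OF assms] by blast
  interpret field_endo \<rho> using subgroup_memD(2)[OF assms] by (rule field_endo_galois)
  have "\<rho> (\<Sum>\<sigma>\<in>S. \<sigma> x) = (\<Sum>\<sigma>\<in>S. (\<rho> \<circ> \<sigma>) x)" by (simp add: sum)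
  also have "\<dots> = (\<Sum>\<sigma>\<in>S. \<sigma> x)"
    by (rule sum.reindex_bij_witness[of _ "\<lambda>\<sigma>. \<rho>' \<circ> \<sigma>" "\<lambda>\<sigma>. \<rho> \<circ> \<sigma>"])
      (use \<rho> \<rho>' subgroup_memD(3)[OF S] in \<open>simp_all flip: comp_assoc\<close>)
  finally show ?thesis .
qed

lemma fixed_field_subring:
  assumes "\<And>\<sigma>. \<sigma> \<in> S \<Longrightarrow> field_endo \<sigma>"
  shows "field_subring (fixed_field S)"
  using assms
  by unfold_locales
    (auto simp: fixed_field_def field_endo.zero field_endo.one field_endo.add field_endo.uminus field_endo.mult)

lemma fixed_field_inverse:
  assumes "\<And>\<sigma>. \<sigma> \<in> S \<Longrightarrow> field_endo \<sigma>" "x \<in> fixed_field S"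
  shows "inverse x \<in> fixed_field S"
  using assms by (simp add: fixed_field_def field_endo.inverse)

lemma K_subset_fixed_field: "S \<subseteq> G \<Longrightarrow> K \<subseteq> fixed_field S"
  by (auto simp: fixed_field_def galois_group_fixes)

lemma separating_G:
  obtains ps where "(\<Sum>(c, f)\<leftarrow>ps. c * f) = 1" "\<forall>\<sigma>\<in>G - {id}. (\<Sum>(c, f)\<leftarrow>ps. c * \<sigma> f) = 0"
proof -
  have "field_subring (UNIV :: 'a set)" by unfold_locales auto
  then have "\<exists>ps. set ps \<subseteq> UNIV \<times> UNIV \<and> (\<Sum>(c, f)\<leftarrow>ps. c * f) = 1 \<and>
    (\<forall>\<sigma>\<in>G - {id}. (\<Sum>(c, f)\<leftarrow>ps. c * \<sigma> f) = 0)"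
    by (intro separating_pairs finite_G field_endo_galois) auto
  then show thesis using that by blast
qed

text \<open>The indicator tensor of the whole group writes 1 as a combination of traces over
  \<open>S\<close>. Since \<open>\<tau>\<close> fixes these traces, each \<open>\<sigma>\<close> in
  them may be replaced by \<open>\<tau> \<circ> \<sigma>\<close>. If \<open>\<tau>\<close> were
  outside \<open>S\<close>, this would never be the identity and the combination would be 0.\<close>

lemma Artin:
  assumes S: "subgroup S (galois_group K)" and \<tau>: "\<tau> \<in> G" "\<And>x. x \<in> fixed_field S \<Longrightarrow> \<tau> x = x"
  shows "\<tau> \<in> S"
proof (rule ccontr)
  assume nS: "\<tau> \<notin> S"
  obtain ps where ps: "(\<Sum>(c, f)\<leftarrow>ps. c * f) = 1" "\<forall>\<sigma>\<in>G - {id}. (\<Sum>(c, f)\<leftarrow>ps. c * \<sigma> f) = 0"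
    by (rule separating_G)
  interpret \<tau>: field_endo \<tau> using \<tau>(1) by (rule field_endo_galois)
  have tr: "\<tau> (\<Sum>\<sigma>\<in>S. \<sigma> f) = (\<Sum>\<sigma>\<in>S. \<sigma> f)" for f
    using trace_fixed[OF S] by (intro \<tau>(2)) (auto simp: fixed_field_def)
  have S': "\<forall>\<sigma>\<in>S - {id}. (\<Sum>(c, f)\<leftarrow>ps. c * \<sigma> f) = 0"
    using ps(2) subgroup_memD(2)[OF S] by auto
  have "(\<Sum>(c, f)\<leftarrow>ps. c * (\<Sum>\<sigma>\<in>S. \<sigma> (f * 1))) = 1"
    by (rule separating_pairs_sum[OF subgroup_finite[OF S] subgroup_memD(1)[OF S] ps(1) S'])
      (rule field_endo_galois[OF subgroup_memD(2)[OF S]])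
  moreover have "(\<Sum>(c, f)\<leftarrow>ps. c * (\<Sum>\<sigma>\<in>S. \<sigma> f)) = (\<Sum>\<sigma>\<in>S. (\<Sum>(c, f)\<leftarrow>ps. c * (\<tau> \<circ> \<sigma>) f))"
  proof -
    have "(\<Sum>(c, f)\<leftarrow>ps. c * (\<Sum>\<sigma>\<in>S. \<sigma> f)) = (\<Sum>(c, f)\<leftarrow>ps. c * \<tau> (\<Sum>\<sigma>\<in>S. \<sigma> f))" by (simp add: tr)
    also have "\<dots> = (\<Sum>\<sigma>\<in>S. (\<Sum>(c, f)\<leftarrow>ps. c * (\<tau> \<circ> \<sigma>) f))"
      by (induction ps) (auto simp: \<tau>.sum sum_distrib_left sum.distrib)
    finally show ?thesis .
  qed
  moreover have "(\<Sum>(c, f)\<leftarrow>ps. c * (\<tau> \<circ> \<sigma>) f) = 0" if \<sigma>: "\<sigma> \<in> S" for \<sigma>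
  proof -
    obtain \<rho> where \<rho>: "\<rho> \<in> S" "\<sigma> \<circ> \<rho> = id" "\<rho> \<circ> \<sigma> = id" using subgroup_memD(4)[OF S \<sigma>] by blast
    have "\<tau> \<circ> \<sigma> \<noteq> id"
    proof
      assume "\<tau> \<circ> \<sigma> = id"
      then have "\<tau> = \<rho>" using \<rho>(2) by (metis comp_assoc comp_id id_comp)
      then show False using nS \<rho> by simp
    qed
    moreover have "\<tau> \<circ> \<sigma> \<in> G" using G.m_closed[of \<tau> \<sigma>] \<tau>(1) subgroup_memD(2)[OF S \<sigma>] by simp
    ultimately show ?thesis using ps(2) by blast
  qed
  ultimately show False by simp
qed

end

section \<open>The fixed fields of the two factors and their compositum\<close>

locale galois_split = galois_ext K for K :: "'a::field set" +
  fixes J G' :: "('a \<Rightarrow> 'a) set"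
  assumes normal: "J \<lhd> galois_group K"
    and subgroup': "subgroup G' (galois_group K)"
    and inter: "J \<inter> G' = {id}"
begin

abbreviation "E \<equiv> fixed_field G'"
abbreviation "F \<equiv> fixed_field J"

lemma subgroup_J: "subgroup J (galois_group K)" using normal by (simp add: normal_def)

lemma endo_J: "\<sigma> \<in> J \<Longrightarrow> field_endo \<sigma>" and endo_G': "\<sigma> \<in> G' \<Longrightarrow> field_endo \<sigma>"
  using subgroup_memD(2)[OF subgroup_J] subgroup_memD(2)[OF subgroup'] field_endo_galois by blast+

sublocale E: field_subring E by (rule fixed_field_subring[OF endo_G'])
sublocale F: field_subring F by (rule fixed_field_subring[OF endo_J])

text \<open>By normality, conjugating \<open>\<sigma>\<close> in \<open>J\<close> by the inverse of
  \<open>\<tau>\<close> gives an element of \<open>J\<close>. It fixes \<open>x\<close>, hence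
  \<open>\<sigma>\<close> fixes \<open>\<tau> x\<close>.\<close>

lemma stable_F:
  assumes "\<tau> \<in> G" "x \<in> F" shows "\<tau> x \<in> F"
  unfolding fixed_field_def
proof (intro CollectI ballI)
  fix \<sigma> assume \<sigma>: "\<sigma> \<in> J"
  obtain \<rho> where \<rho>: "\<rho> \<in> G" "\<tau> \<circ> \<rho> = id" "\<rho> \<circ> \<tau> = id"
    using subgroup_memD(4)[OF G.subgroup_self assms(1)] by blast
  have conj: "\<rho> \<otimes>\<^bsub>galois_group K\<^esub> \<sigma> \<otimes>\<^bsub>galois_group K\<^esub> inv\<^bsub>galois_group K\<^esub> \<rho> \<in> J"
    using normal \<sigma> \<rho>(1) by (simp add: normal.inv_op_closed2 del: galois_group_simps)
  have "inv\<^bsub>galois_group K\<^esub> \<rho> = \<tau>"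
    using \<rho> assms(1) by (intro G.inv_equality) auto
  with conj have "\<rho> \<circ> \<sigma> \<circ> \<tau> \<in> J" by simp
  then have "(\<rho> \<circ> \<sigma> \<circ> \<tau>) x = x" using assms(2) unfolding fixed_field_def by blast
  then have "\<tau> (\<rho> (\<sigma> (\<tau> x))) = \<tau> x" by simp
  then show "\<sigma> (\<tau> x) = \<tau> x" using \<rho>(2) by (metis comp_apply id_apply)
qed

text \<open>A nontrivial element of \<open>G'\<close> lies outside \<open>J\<close> and so, by
  Artin's theorem, moves some element of \<open>F\<close>. This provides an indicator tensor for
  \<open>G'\<close> with both entries in \<open>F\<close>; the traces over \<open>G'\<close> from
  which it recovers \<open>x\<close> lie in \<open>E\<close>.\<close>

lemma compositum:
  obtains ps where "set ps \<subseteq> F \<times> E" "x = (\<Sum>(c, e)\<leftarrow>ps. c * e)"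
proof -
  have "\<exists>ps. set ps \<subseteq> F \<times> F \<and> (\<Sum>(c, f)\<leftarrow>ps. c * f) = 1 \<and>
    (\<forall>\<sigma>\<in>G' - {id}. (\<Sum>(c, f)\<leftarrow>ps. c * \<sigma> f) = 0)"
  proof (rule separating_pairs)
    show "\<exists>a\<in>F. \<sigma> a \<noteq> a" if "\<sigma> \<in> G'" "\<sigma> \<noteq> id" for \<sigma>
      using Artin[OF subgroup_J] that inter subgroup_memD(2)[OF subgroup'] by blast
  qed (use subgroup_finite[OF subgroup'] endo_G' F.field_subring_axioms fixed_field_inverse[OF endo_J]
      stable_F subgroup_memD(2)[OF subgroup'] in auto)
  then obtain ps where ps: "set ps \<subseteq> F \<times> F" "(\<Sum>(c, f)\<leftarrow>ps. c * f) = 1"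
    "\<forall>\<sigma>\<in>G' - {id}. (\<Sum>(c, f)\<leftarrow>ps. c * \<sigma> f) = 0"
    by blast
  have "x = (\<Sum>(c, f)\<leftarrow>ps. c * (\<Sum>\<sigma>\<in>G'. \<sigma> (f * x)))"
    using separating_pairs_sum[OF subgroup_finite[OF subgroup'] subgroup_memD(1)[OF subgroup'] ps(2,3) endo_G'] by simp
  also have "\<dots> = (\<Sum>(c, e)\<leftarrow>map (\<lambda>(c, f). (c, \<Sum>\<sigma>\<in>G'. \<sigma> (f * x))) ps. c * e)"
    by (simp add: case_prod_unfold comp_def)
  finally have eq: "x = (\<Sum>(c, e)\<leftarrow>map (\<lambda>(c, f). (c, \<Sum>\<sigma>\<in>G'. \<sigma> (f * x))) ps. c * e)" .
  have "(\<Sum>\<sigma>\<in>G'. \<sigma> y) \<in> E" for y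
    using trace_fixed[OF subgroup'] by (simp add: fixed_field_def)
  then have "set (map (\<lambda>(c, f). (c, \<Sum>\<sigma>\<in>G'. \<sigma> (f * x))) ps) \<subseteq> F \<times> E"
    using ps(1) by auto
  then show thesis using eq by (rule that)
qed

text \<open>Arithmetic disjointness speaks of the integral closure in the field generated by
  \<open>E\<close> and \<open>F\<close>; this identifies it with the ring of integers of the top
  field.\<close>

lemma generate_field_eq_UNIV: "generate_field top_ring (E \<union> F) = UNIV"
proof -
  have "x \<in> generate_field top_ring (E \<union> F)" for x
  proof -
    obtain ps where ps: "set ps \<subseteq> F \<times> E" "x = (\<Sum>(c, e)\<leftarrow>ps. c * e)" by (rule compositum)
    have z: "0 \<in> generate_field top_ring (E \<union> F)" using E.zero_mem by (auto intro: generate_field.incl)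
    have "(\<Sum>(c, e)\<leftarrow>ps. c * e) \<in> generate_field top_ring (E \<union> F)"
      using ps(1)
    proof (induction ps)
      case (Cons p ps)
      obtain c e where p: "p = (c, e)" "c \<in> F" "e \<in> E" using Cons.prems by (cases p) auto
      have "c * e \<in> generate_field top_ring (E \<union> F)"
        using generate_field.eng_mult[of c top_ring "E \<union> F" e] p by (auto intro: generate_field.incl)
      then show ?case
        using generate_field.eng_add[of "c * e" top_ring "E \<union> F"] Cons p by auto
    qed (use z in simp)
    then show ?thesis using ps(2) by simp
  qed
  then show ?thesis by blast
qed

end

section \<open>Integral closures in a Galois extension are free\<close>

locale galois_pid = galois_ext K + pid_subring R for K R :: "'a::field set" +
  assumes quotient: "K = quotient_field R"
begin

lemma R_subset_K: "R \<subseteq> K"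
  using one_mem by (force simp: quotient quotient_field_def)

lemma common_denominator:
  assumes "finite I" "\<And>i. i \<in> I \<Longrightarrow> f i \<in> K"
  obtains D where "D \<in> R" "D \<noteq> 0" "\<And>i. i \<in> I \<Longrightarrow> D * f i \<in> R"
proof -
  have "\<exists>D\<in>R. D \<noteq> 0 \<and> (\<forall>i\<in>I. D * f i \<in> R)"
    using assms
  proof (induction I rule: finite_induct)
    case empty
    then show ?case using one_mem by (auto intro!: bexI[of _ 1])
  next
    case (insert i I)
    then obtain D where D: "D \<in> R" "D \<noteq> 0" "\<forall>i\<in>I. D * f i \<in> R" by auto
    obtain a b where ab: "a \<in> R" "b \<in> R" "b \<noteq> 0" "f i = a / b"
      using insert.prems[of i] by (auto simp: quotient quotient_field_def)
    have "b * D * f i = D * a" using ab by simp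
    then show ?case
      using D ab by (intro bexI[of _ "b * D"]) (auto simp: mult_mem mult.assoc)
  qed
  then show thesis using that by blast
qed

text \<open>After clearing denominators let \<open>a\<close> be the leading coefficient of an
  equation of degree \<open>n\<close>. Multiplying by \<open>a ^ (n - 1)\<close> makes the equation
  monic in \<open>a * x\<close>, with coefficients that are products of the \<open>c i\<close> and
  powers of \<open>a\<close>.\<close>

lemma integral_multiple:
  obtains D where "D \<in> R" "D \<noteq> 0" "D * x \<in> integral_closure R UNIV"
proof -
  obtain p where p: "p \<noteq> 0" "range (Polynomial.coeff p) \<subseteq> K" "Polynomial.poly p x = 0"
    by (rule algebraic)
  define n where "n = Polynomial.degree p"
  obtain D where D: "D \<in> R" "D \<noteq> 0" "\<And>i. i \<in> {..n} \<Longrightarrow> D * Polynomial.coeff p i \<in> R"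
    by (rule common_denominator[of "{..n}" "Polynomial.coeff p"]) (use p(2) in auto)
  define c where "c i = D * Polynomial.coeff p i" for i
  define a where "a = c n"
  have c: "c i \<in> R" for i
    using D(3)[of i] zero_mem by (cases "i \<le> n") (auto simp: c_def n_def coeff_eq_0)
  have a: "a \<noteq> 0" using D(2) p(1) by (simp add: a_def c_def n_def)
  have root: "(\<Sum>i<n. c i * x ^ i) + a * x ^ n = 0"
  proof -
    have "(\<Sum>i<n. c i * x ^ i) + a * x ^ n = D * Polynomial.poly p x"
      by (simp add: poly_altdef a_def c_def n_def sum_distrib_left distrib_left mult.assoc flip: lessThan_Suc_atMost)
    then show ?thesis using p(3) by simp
  qed
  then obtain m where m: "n = Suc m" using a by (cases n) auto
  have "(a * x) ^ n = a ^ m * (a * x ^ n)" by (simp add: m power_mult_distrib mult_ac)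
  also have "\<dots> = a ^ m * - (\<Sum>i<n. c i * x ^ i)" using root by (metis eq_neg_iff_add_eq_0 add.commute)
  also have "\<dots> = (\<Sum>i<n. - (c i * a ^ (m - i)) * (a * x) ^ i)"
  proof -
    have "a ^ m * (c i * x ^ i) = c i * a ^ (m - i) * (a * x) ^ i" if "i < n" for i
      using that m power_add[of a "m - i" i] by (simp add: power_mult_distrib mult_ac)
    then have "(\<Sum>i<n. a ^ m * (c i * x ^ i)) = (\<Sum>i<n. c i * a ^ (m - i) * (a * x) ^ i)"
      by (intro sum.cong refl) simp_all
    then show ?thesis by (simp only: mult_minus_right mult_minus_left sum_distrib_left sum_negf)
  qed
  finally have "a * x \<in> integral_closure R UNIV"
    unfolding integral_closure_iff
    by (intro conjI UNIV_I exI[of _ n] exI[of _ "\<lambda>i. - (c i * a ^ (m - i))"])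
      (auto simp: a_def intro!: uminus_mem mult_mem power_mem c)
  then show thesis using that[of a] c[of n] a by (simp add: a_def)
qed

lemma integral_conjugate:
  assumes "\<sigma> \<in> G" "x \<in> integral_closure R UNIV" shows "\<sigma> x \<in> integral_closure R UNIV"
proof -
  interpret \<sigma>: field_endo \<sigma> using assms(1) by (rule field_endo_galois)
  obtain n c where c: "\<forall>i. c i \<in> R" "x ^ n = (\<Sum>i<n. c i * x ^ i)"
    using assms(2) by (auto simp: integral_closure_iff)
  have "\<sigma> x ^ n = (\<Sum>i<n. c i * \<sigma> x ^ i)"
    using arg_cong[OF c(2), of \<sigma>] c(1) R_subset_K galois_group_fixes[OF assms(1)]
    by (auto simp: \<sigma>.power \<sigma>.sum \<sigma>.mult subset_iff)
  then show ?thesis using c(1) by (auto simp: integral_closure_iff)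
qed

lemma integral_ring: "field_subring (integral_closure R UNIV)"
  by (rule field_subring_integral_closure) (unfold_locales, auto)

text \<open>The trace is fixed by the whole group, so it lies in the fraction field of
  \<open>R\<close>; being integral as well, it lies in \<open>R\<close>.\<close>

lemma trace_mem:
  assumes "x \<in> integral_closure R UNIV" shows "(\<Sum>\<sigma>\<in>G. \<sigma> x) \<in> R"
proof (rule integrally_closed)
  have "(\<Sum>\<sigma>\<in>G. \<sigma> x) \<in> fixed_field G"
    using trace_fixed[OF G.subgroup_self] by (auto simp: fixed_field_def)
  then show "(\<Sum>\<sigma>\<in>G. \<sigma> x) \<in> quotient_field R"
    using finite_galois quotient by (simp add: finite_galois_def)
  show "(\<Sum>\<sigma>\<in>G. \<sigma> x) \<in> integral_closure R UNIV"
    using assms integral_conjugate by (intro field_subring.sum_mem[OF integral_ring]) auto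
qed

text \<open>The trace form is non-degenerate, so finitely many functionals \<open>x \<mapsto> Tr (f x)\<close> embed the
  integral closure in a free module.\<close>

lemma integral_closure_free:
  assumes M: "field_subring M" and RM: "R \<subseteq> M"
  shows "\<exists>z d. module_basis R (integral_closure R M) z d"
proof -
  interpret I: field_subring "integral_closure R UNIV" by (rule integral_ring)
  interpret IM: field_subring "integral_closure R M" by (rule field_subring_integral_closure[OF M])
  have RI: "R \<subseteq> integral_closure R M" using integral_self RM by (auto simp: integral_closure_Int[of M])
  have sub: "integral_closure R M \<subseteq> integral_closure R UNIV" by (auto simp: integral_closure_def)
  obtain ps where ps: "(\<Sum>(c, f)\<leftarrow>ps. c * f) = 1" "\<forall>\<sigma>\<in>G - {id}. (\<Sum>(c, f)\<leftarrow>ps. c * \<sigma> f) = 0"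
    by (rule separating_G)
  \<comment> \<open>\<open>D f\<close> scales \<open>f\<close> into the ring of integers, so that
    the functional \<open>tr f\<close> sends integers into \<open>R\<close>. As a nonzero element of
    \<open>R\<close> it does not change where the functional vanishes.\<close>
  obtain D where D: "\<And>x. D x \<in> R" "\<And>x. D x \<noteq> 0" "\<And>x. D x * x \<in> integral_closure R UNIV"
  proof -
    have "\<exists>D. D \<in> R \<and> D \<noteq> 0 \<and> D * x \<in> integral_closure R UNIV" for x
      by (rule integral_multiple[of x]) blast
    then show thesis using that by metis
  qed
  define tr where "tr f x = (\<Sum>\<sigma>\<in>G. \<sigma> (D f * f * x))" for f x
  have endo: "\<sigma> \<in> G \<Longrightarrow> field_endo \<sigma>" for \<sigma> by (rule field_endo_galois)
  have fixR: "\<sigma> r = r" if "\<sigma> \<in> G" "r \<in> R" for \<sigma> r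
    using that R_subset_K galois_group_fixes by blast
  have sum_R: "(\<Sum>\<sigma>\<in>G. \<sigma> (r * x)) = r * (\<Sum>\<sigma>\<in>G. \<sigma> x)" if "r \<in> R" for r x
    using that by (auto simp: sum_distrib_left field_endo.mult[OF endo] fixR intro!: sum.cong)
  show ?thesis
  proof (rule free_if_separated[where fs = "map (tr \<circ> snd) ps"])
    show "g (x + y) = g x + g y" if "g \<in> set (map (tr \<circ> snd) ps)" for g x y
      using that by (auto simp: tr_def distrib_left field_endo.add[OF endo] sum.distrib)
    show "g (r * x) = r * g x" if "g \<in> set (map (tr \<circ> snd) ps)" "r \<in> R" for g r x
      using that(1) sum_R[OF that(2)] by (auto simp: tr_def mult.left_commute[of _ r])
    show "g x \<in> R" if g: "g \<in> set (map (tr \<circ> snd) ps)" "x \<in> integral_closure R M" for g x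
    proof -
      obtain f where "g = tr f" using g(1) by auto
      moreover have "D f * f * x \<in> integral_closure R UNIV" using I.mult_mem[OF D(3)[of f]] g(2) sub by blast
      ultimately show ?thesis by (simp add: tr_def trace_mem)
    qed
    show "x = 0" if "\<And>g. g \<in> set (map (tr \<circ> snd) ps) \<Longrightarrow> g x = 0" for x
    proof -
      have tr0: "(\<Sum>\<sigma>\<in>G. \<sigma> (f * x)) = 0" if f: "(c, f) \<in> set ps" for c f
      proof -
        have "tr f x = 0" using \<open>\<And>g. g \<in> set (map (tr \<circ> snd) ps) \<Longrightarrow> g x = 0\<close> f by force
        then show ?thesis using sum_R[OF D(1)[of f], of "f * x"] D(2)[of f] by (simp add: tr_def mult.assoc)
      qed
      \<comment> \<open>If all these traces vanish, so does the expression that recovers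
        \<open>x\<close> from them.\<close>
      have "map (\<lambda>(c, f). c * (\<Sum>\<sigma>\<in>G. \<sigma> (f * x))) ps = map (\<lambda>_. 0) ps"
        by (rule map_cong) (auto simp: tr0)
      then have "(\<Sum>(c, f)\<leftarrow>ps. c * (\<Sum>\<sigma>\<in>G. \<sigma> (f * x))) = 0"
        by (simp only: sum_list_0)
      then show "x = 0"
        using separating_pairs_sum[OF finite_G _ ps endo, of x] subgroup_memD(1)[OF G.subgroup_self] by simp
    qed
  qed (use RI IM.zero_mem IM.add_mem IM.mult_mem in auto)
qed

end


section \<open>The Hopf algebra and its action\<close>

abbreviation scale_coeffs :: "'a::field \<Rightarrow> ('n \<Rightarrow>\<^sub>0 'a) \<Rightarrow> ('n \<Rightarrow>\<^sub>0 'a)"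
  where "scale_coeffs k \<equiv> Poly_Mapping.map ((*) k)"

lemma lookup_scale_coeffs [simp]: "Poly_Mapping.lookup (scale_coeffs k c) n = k * Poly_Mapping.lookup c n"
  by (simp add: Poly_Mapping.map.rep_eq when_def)

lemma keys_scale_coeffs: "Poly_Mapping.keys (scale_coeffs k c) \<subseteq> Poly_Mapping.keys c"
  by (auto simp: in_keys_iff)

text \<open>The defining sum runs over the support, which varies with \<open>c\<close>. A common
  index set makes additivity visible; the extra terms have coefficient 0.\<close>

lemma hopf_action_superset:
  assumes "finite A" "Poly_Mapping.keys c \<subseteq> A"
  shows "hopf_action Y c x = (\<Sum>n\<in>A. Poly_Mapping.lookup c n * ((inv\<^bsub>BijGroup Y\<^esub> n) id) x)"
  unfolding hopf_action_def
  by (rule sum.mono_neutral_left) (use assms in \<open>auto simp: in_keys_iff\<close>)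

lemma hopf_action_add: "hopf_action Y (c + d) x = hopf_action Y c x + hopf_action Y d x"
proof -
  let ?A = "Poly_Mapping.keys c \<union> Poly_Mapping.keys d"
  have "Poly_Mapping.keys (c + d) \<subseteq> ?A" by (rule keys_add)
  then show ?thesis
    by (simp add: hopf_action_superset[of ?A] lookup_add distrib_right sum.distrib)
qed

lemma hopf_action_zero: "hopf_action Y 0 x = 0"
  by (simp add: hopf_action_def)

lemma hopf_action_sum: "hopf_action Y (sum f I) x = (\<Sum>i\<in>I. hopf_action Y (f i) x)"
  by (induction I rule: infinite_finite_induct) (simp_all add: hopf_action_zero hopf_action_add)

lemma hopf_action_scale: "hopf_action Y (scale_coeffs k c) x = k * hopf_action Y c x"
  by (subst hopf_action_superset[OF finite_keys keys_scale_coeffs])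
    (simp add: hopf_action_def sum_distrib_left mult.assoc)

lemma hopf_action_single: "hopf_action Y (Poly_Mapping.single n a) x = a * ((inv\<^bsub>BijGroup Y\<^esub> n) id) x"
  by (simp add: hopf_action_superset[of "{n}"])

lemma galois_action_superset:
  assumes "finite A" "Poly_Mapping.keys c \<subseteq> A" "g 0 = 0"
  shows "galois_action P \<rho> g c =
    (\<Sum>n\<in>A. Poly_Mapping.single (\<rho> g \<otimes>\<^bsub>P\<^esub> n \<otimes>\<^bsub>P\<^esub> inv\<^bsub>P\<^esub> (\<rho> g)) (g (Poly_Mapping.lookup c n)))"
  unfolding galois_action_def
  by (rule sum.mono_neutral_left) (use assms in \<open>auto simp: in_keys_iff\<close>)

lemma galois_action_add:
  assumes "field_endo g"
  shows "galois_action P \<rho> g (c + d) = galois_action P \<rho> g c + galois_action P \<rho> g d"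
proof -
  interpret field_endo g by fact
  let ?A = "Poly_Mapping.keys c \<union> Poly_Mapping.keys d"
  have "Poly_Mapping.keys (c + d) \<subseteq> ?A" by (rule keys_add)
  then show ?thesis
    by (simp add: galois_action_superset[of ?A] lookup_add add zero single_add sum.distrib)
qed

lemma galois_action_scale:
  assumes "field_endo g" "g k = k"
  shows "galois_action P \<rho> g (scale_coeffs k c) = scale_coeffs k (galois_action P \<rho> g c)"
proof -
  interpret field_endo g by fact
  show ?thesis
    by (rule poly_mapping_eqI)
      (simp add: galois_action_superset[of "Poly_Mapping.keys c"] keys_scale_coeffs zero lookup_sum lookup_single
        mult assms(2) sum_distrib_left when_def if_distrib cong: if_cong)
qed

lemma hopf_algebra_simps [simp]:
  "carrier (hopf_algebra UNIV \<Gamma> P \<rho> N) =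
    {c. Poly_Mapping.keys c \<subseteq> N \<and> (\<forall>g\<in>\<Gamma>. galois_action P \<rho> g c = c)}"
  "c \<oplus>\<^bsub>hopf_algebra UNIV \<Gamma> P \<rho> N\<^esub> d = c + d"
  "\<zero>\<^bsub>hopf_algebra UNIV \<Gamma> P \<rho> N\<^esub> = 0"
  "k \<odot>\<^bsub>hopf_algebra UNIV \<Gamma> P \<rho> N\<^esub> c = scale_coeffs k c"
  by (auto simp: hopf_algebra_def group_algebra_def)

lemma scale_coeffs_add: "scale_coeffs k (c + d) = scale_coeffs k c + scale_coeffs k d"
  by (rule poly_mapping_eqI) (simp add: lookup_add distrib_left)

lemma scale_coeffs_add_left: "scale_coeffs (k + l) c = scale_coeffs k c + scale_coeffs l c"
  by (rule poly_mapping_eqI) (simp add: lookup_add distrib_right)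

lemma scale_coeffs_mult: "scale_coeffs (k * l) c = scale_coeffs k (scale_coeffs l c)"
  by (rule poly_mapping_eqI) (simp add: mult.assoc)

lemma scale_coeffs_one: "scale_coeffs 1 c = c"
  by (rule poly_mapping_eqI) simp

lemma scale_coeffs_minus_one: "scale_coeffs (- 1) c = - c"
  by (rule poly_mapping_eqI) simp

text \<open>Stated for a smaller carrier \<open>A\<close> and a smaller ring of scalars, to cover associated orders.\<close>

lemma (in field_subring) module_hopf_suborder:
  assumes "0 \<in> A" "\<And>c d. c \<in> A \<Longrightarrow> d \<in> A \<Longrightarrow> c + d \<in> A" "\<And>k c. k \<in> R \<Longrightarrow> c \<in> A \<Longrightarrow> scale_coeffs k c \<in> A"
  shows "module (subring_of R) (hopf_algebra UNIV \<Gamma> P \<rho> N\<lparr>carrier := A\<rparr>)" (is "module _ ?H")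
proof (rule moduleI)
  have H: "carrier ?H = A" "c \<oplus>\<^bsub>?H\<^esub> d = c + d" "\<zero>\<^bsub>?H\<^esub> = 0" "k \<odot>\<^bsub>?H\<^esub> c = scale_coeffs k c" for c d k
    by (simp_all add: hopf_algebra_def group_algebra_def)
  show "abelian_group ?H"
  proof (rule abelian_groupI)
    show "\<exists>d\<in>carrier ?H. d \<oplus>\<^bsub>?H\<^esub> c = \<zero>\<^bsub>?H\<^esub>" if "c \<in> carrier ?H" for c
      using assms(3)[OF uminus_mem[OF one_mem], of c] that
      by (intro bexI[of _ "- c"]) (simp_all add: H scale_coeffs_minus_one)
  qed (simp_all add: H assms(1,2) add_ac)
  show "cring (subring_of R)" by (rule cring_subring_of)
qed (simp_all add: hopf_algebra_def group_algebra_def assms scale_coeffs_add scale_coeffs_add_left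
    scale_coeffs_mult scale_coeffs_one)

text \<open>That \<open>lambda_c J G' \<tau>\<close> is a permutation of \<open>J\<close> is assumed
  here on \<open>G'\<close> and will be extracted from the normalizer condition of the induced
  structure.\<close>

locale hopf_setup = galois_split K J G' for K :: "'a::field set" and J G' +
  fixes N1 :: "(('a \<Rightarrow> 'a) \<Rightarrow> ('a \<Rightarrow> 'a)) set"
  assumes N1_subgroup: "subgroup N1 (BijGroup J)"
    and lambda_c_closed: "\<tau> \<in> G' \<Longrightarrow> lambda_c J G' \<tau> \<in> carrier (BijGroup J)"
begin

abbreviation "B \<equiv> BijGroup J"
abbreviation "H1 \<equiv> hopf_algebra UNIV G B (lambda_c J G') N1"
abbreviation "act \<equiv> hopf_action J"

sublocale B: Group.group B by (rule group_BijGroup)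

lemma B_mult: "f \<in> carrier B \<Longrightarrow> g \<in> carrier B \<Longrightarrow> s \<in> J \<Longrightarrow> (f \<otimes>\<^bsub>B\<^esub> g) s = f (g s)"
  by (simp add: BijGroup_def compose_def)

lemma B_maps: "f \<in> carrier B \<Longrightarrow> s \<in> J \<Longrightarrow> f s \<in> J"
  by (auto simp: BijGroup_def Bij_def bij_betw_def)

lemma B_one: "s \<in> J \<Longrightarrow> \<one>\<^bsub>B\<^esub> s = s"
  by (simp add: BijGroup_def)

lemma B_inv:
  assumes "f \<in> carrier B" "s \<in> J" shows "(inv\<^bsub>B\<^esub> f) (f s) = s"
  using B_mult[OF B.inv_closed[OF assms(1)] assms] B.l_inv[OF assms(1)] B_one[OF assms(2)] by simp

lemma id_J: "id \<in> J" by (rule subgroup_memD(1)[OF subgroup_J])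

text \<open>Each element of \<open>N1\<close> acts on the field through an automorphism over
  \<open>K\<close>, which is why the action is \<open>K\<close>-linear.\<close>

lemma N1_inv_id: "n \<in> N1 \<Longrightarrow> (inv\<^bsub>B\<^esub> n) id \<in> G"
  using subgroup.mem_carrier[OF N1_subgroup] B.inv_closed B_maps id_J subgroup_memD(2)[OF subgroup_J] by blast

lemma H1_keys: "c \<in> carrier H1 \<Longrightarrow> n \<in> Poly_Mapping.keys c \<Longrightarrow> n \<in> N1"
  by auto

lemma module_H1: "module (subring_of K) H1"
proof -
  have "module (subring_of K) (H1\<lparr>carrier := carrier H1\<rparr>)"
  proof (rule K.module_hopf_suborder)
    show "c + d \<in> carrier H1" if "c \<in> carrier H1" "d \<in> carrier H1" for c d
      using that keys_add[of c d] by (auto simp: galois_action_add field_endo_galois)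
    show "scale_coeffs k c \<in> carrier H1" if "k \<in> K" "c \<in> carrier H1" for k c
      using that keys_scale_coeffs[of k c]
      by (auto simp: galois_action_scale field_endo_galois galois_group_fixes)
  qed (auto simp: galois_action_def)
  moreover have "H1\<lparr>carrier := carrier H1\<rparr> = H1" by (simp add: hopf_algebra_def)
  ultimately show ?thesis by (simp only:)
qed

lemma act_add_right:
  assumes "c \<in> carrier H1" shows "act c (x + y) = act c x + act c y"
  using H1_keys[OF assms] field_endo.add[OF field_endo_galois[OF N1_inv_id]]
  by (simp add: hopf_action_def distrib_left sum.distrib)

lemma act_scale_right:
  assumes "c \<in> carrier H1" "k \<in> K" shows "act c (k * x) = k * act c x"
  using H1_keys[OF assms(1)] field_endo.mult[OF field_endo_galois[OF N1_inv_id]]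
    galois_group_fixes[OF N1_inv_id assms(2)]
  by (simp add: hopf_action_def sum_distrib_left mult_ac)

text \<open>Since \<open>J\<close> and \<open>G'\<close> meet trivially, the only factorisation of
  \<open>\<tau>\<close> in \<open>G'\<close> is \<open>id \<circ> \<tau>\<close>. The definite
  description therefore picks conjugation by \<open>\<tau>\<close>.\<close>

lemma lambda_c_eq:
  assumes \<tau>: "\<tau> \<in> G'" and s: "s \<in> J"
  shows "lambda_c J G' \<tau> s = \<tau> \<circ> s \<circ> inv_into UNIV \<tau>"
proof -
  have unique: "\<sigma> = id \<and> \<tau>' = \<tau>" if u: "\<sigma> \<in> J" "\<tau>' \<in> G'" "\<tau> = \<sigma> \<circ> \<tau>'" for \<sigma> \<tau>'
  proof -
    obtain \<rho> where \<rho>: "\<rho> \<in> G'" "\<tau>' \<circ> \<rho> = id" using subgroup_memD(4)[OF subgroup' u(2)] by blast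
    have "\<tau> \<circ> \<rho> = \<sigma>" using u(3) \<rho>(2) by (simp add: comp_assoc)
    then have "\<sigma> \<in> G'" using subgroup_memD(3)[OF subgroup' \<tau> \<rho>(1)] by simp
    then have "\<sigma> = id" using u(1) inter by blast
    then show ?thesis using u(3) by simp
  qed
  have "(THE r. \<exists>\<sigma>\<in>J. \<exists>\<tau>'\<in>G'. \<tau> = \<sigma> \<circ> \<tau>' \<and> r = \<sigma> \<circ> \<tau>' \<circ> s \<circ> inv_into UNIV \<tau>') = \<tau> \<circ> s \<circ> inv_into UNIV \<tau>"
  proof (rule the_equality)
    show "\<exists>\<sigma>\<in>J. \<exists>\<tau>'\<in>G'. \<tau> = \<sigma> \<circ> \<tau>' \<and> \<tau> \<circ> s \<circ> inv_into UNIV \<tau> = \<sigma> \<circ> \<tau>' \<circ> s \<circ> inv_into UNIV \<tau>'"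
      using id_J \<tau> by (intro bexI[of _ id] bexI[of _ \<tau>]) simp_all
    show "r = \<tau> \<circ> s \<circ> inv_into UNIV \<tau>"
      if "\<exists>\<sigma>\<in>J. \<exists>\<tau>'\<in>G'. \<tau> = \<sigma> \<circ> \<tau>' \<and> r = \<sigma> \<circ> \<tau>' \<circ> s \<circ> inv_into UNIV \<tau>'" for r
    proof -
      from that obtain \<sigma> \<tau>' where r: "\<sigma> \<in> J" "\<tau>' \<in> G'" "\<tau> = \<sigma> \<circ> \<tau>'" "r = \<sigma> \<circ> \<tau>' \<circ> s \<circ> inv_into UNIV \<tau>'"
        by blast
      have "\<sigma> = id" "\<tau>' = \<tau>" using unique[OF r(1-3)] by blast+
      then show ?thesis using r(4) by simp
    qed
  qed
  then show ?thesis using s by (simp add: lambda_c_def)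
qed

text \<open>Galois descent. Conjugation by \<open>\<tau>\<close> fixes \<open>id\<close>, so passing
  from \<open>n\<close> to its conjugate under \<open>lambda_c J G' \<tau>\<close> replaces the
  automorphism through which \<open>n\<close> acts by its conjugate under \<open>\<tau>\<close>. On
  \<open>x\<close> in \<open>E\<close> this acts as the original automorphism followed by
  \<open>\<tau>\<close>. As \<open>c\<close> is invariant under the Galois action,
  \<open>act c x\<close> equals its own image under \<open>\<tau>\<close>.\<close>

lemma act_E:
  assumes c: "c \<in> carrier H1" and x: "x \<in> E" shows "act c x \<in> E"
  unfolding fixed_field_def
proof (intro CollectI ballI)
  fix \<tau> assume \<tau>: "\<tau> \<in> G'"
  then have \<tau>G: "\<tau> \<in> G" by (rule subgroup_memD(2)[OF subgroup'])
  interpret \<tau>: field_endo \<tau> using \<tau>G by (rule field_endo_galois)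
  have inj: "inj \<tau>" using \<tau>G by (simp add: galois_group_carrier_iff bij_is_inj)
  have \<tau>x: "\<tau> x = x" using x \<tau> by (simp add: fixed_field_def)
  have inv_x: "inv_into UNIV \<tau> x = x" using inv_f_f[OF inj, of x] \<tau>x by simp
  define l where "l = lambda_c J G' \<tau>"
  have l: "l \<in> carrier B" using lambda_c_closed[OF \<tau>] by (simp add: l_def)
  have "bij \<tau>" using \<tau>G by (simp add: galois_group_carrier_iff)
  then have "\<tau> \<circ> inv_into UNIV \<tau> = id" using bij_is_surj surj_iff by blast
  then have "l id = id" using lambda_c_eq[OF \<tau> id_J] by (simp add: l_def)
  then have linv: "(inv\<^bsub>B\<^esub> l) id = id" using B_inv[OF l id_J] by simp
  have key: "((inv\<^bsub>B\<^esub> (l \<otimes>\<^bsub>B\<^esub> n \<otimes>\<^bsub>B\<^esub> inv\<^bsub>B\<^esub> l)) id) x = \<tau> (((inv\<^bsub>B\<^esub> n) id) x)" if n: "n \<in> N1" for n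
  proof -
    have nB: "n \<in> carrier B" using subgroup.mem_carrier[OF N1_subgroup n] .
    have "inv\<^bsub>B\<^esub> (l \<otimes>\<^bsub>B\<^esub> n \<otimes>\<^bsub>B\<^esub> inv\<^bsub>B\<^esub> l) = l \<otimes>\<^bsub>B\<^esub> (inv\<^bsub>B\<^esub> n \<otimes>\<^bsub>B\<^esub> inv\<^bsub>B\<^esub> l)"
      using l nB by (simp add: B.inv_mult_group)
    then have "(inv\<^bsub>B\<^esub> (l \<otimes>\<^bsub>B\<^esub> n \<otimes>\<^bsub>B\<^esub> inv\<^bsub>B\<^esub> l)) id = l ((inv\<^bsub>B\<^esub> n) id)"
      using l nB id_J linv by (simp add: B_mult)
    also have "\<dots> = \<tau> \<circ> (inv\<^bsub>B\<^esub> n) id \<circ> inv_into UNIV \<tau>"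
      unfolding l_def by (rule lambda_c_eq[OF \<tau>]) (use nB id_J B_maps in simp)
    finally show ?thesis by (simp add: inv_x)
  qed
  have "act c x = act (galois_action B (lambda_c J G') \<tau> c) x"
    using c \<tau>G by simp
  also have "\<dots> = (\<Sum>n\<in>Poly_Mapping.keys c. \<tau> (Poly_Mapping.lookup c n) * \<tau> (((inv\<^bsub>B\<^esub> n) id) x))"
    using H1_keys[OF c] key
    by (simp add: galois_action_def hopf_action_sum hopf_action_single l_def)
  also have "\<dots> = \<tau> (act c x)"
    by (simp add: hopf_action_def \<tau>.sum \<tau>.mult)
  finally show "\<tau> (act c x) = act c x" by simp
qed

end


section \<open>Coordinates in the base change\<close>

text \<open>\<open>lin_disjoint\<close> will give uniqueness of coordinates over \<open>E\<close>
  with respect to \<open>z\<close>, and \<open>arith\<close> their existence over the integers of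
  \<open>E\<close>.\<close>

locale arithmetic_setup = hopf_setup K J G' N1 + galois_pid K R
  for K :: "'a::field set" and J G' N1 R +
  fixes z :: "nat \<Rightarrow> 'a" and d :: nat
  assumes lin_disjoint: "linearly_disjoint K (fixed_field G') (fixed_field J)"
    and arith: "mult_map R (integral_closure R (fixed_field G')) (integral_closure R (fixed_field J)) `
      carrier (field_tensor R (integral_closure R (fixed_field G')) (integral_closure R (fixed_field J)))
      = integral_closure R UNIV"
    and basis_OF: "module_basis R (integral_closure R (fixed_field J)) z d"
begin

abbreviation "OE \<equiv> integral_closure R E"
abbreviation "OF \<equiv> integral_closure R F"
abbreviation "OL \<equiv> integral_closure R UNIV"
abbreviation "A1 \<equiv> associated_order (carrier H1) act OE"
abbreviation "HA \<equiv> H1\<lparr>carrier := A1\<rparr>"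
abbreviation "H1F \<equiv> tensor_product (subring_of K) H1 (mult_module F)"

sublocale OE: field_subring OE by (rule field_subring_integral_closure[OF E.field_subring_axioms])
sublocale OF: field_subring OF by (rule field_subring_integral_closure[OF F.field_subring_axioms])
sublocale OL: field_subring OL by (rule integral_ring)

lemma K_E: "K \<subseteq> E" and K_F: "K \<subseteq> F"
  using subgroup.subset[OF subgroup'] subgroup.subset[OF subgroup_J] K_subset_fixed_field by blast+

lemma OE_iff: "x \<in> OE \<longleftrightarrow> x \<in> OL \<and> x \<in> E" and OF_iff: "x \<in> OF \<longleftrightarrow> x \<in> OL \<and> x \<in> F"
  using integral_closure_Int[of E] integral_closure_Int[of F] by auto

lemma R_OE: "R \<subseteq> OE" and R_OF: "R \<subseteq> OF"
  using R_subset_K K_E K_F by (auto simp: OE_iff OF_iff integral_self)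

lemma OF_span: "OF = {\<Sum>i<d. c i * z i | c. \<forall>i<d. c i \<in> R}"
  using basis_OF by (simp add: module_basis_def)

lemma OF_indep: "\<forall>i<d. c i \<in> R \<Longrightarrow> (\<Sum>i<d. c i * z i) = 0 \<Longrightarrow> i < d \<Longrightarrow> c i = 0"
  using basis_OF by (simp add: module_basis_def)

text \<open>Clearing denominators: every element of \<open>F\<close> has a nonzero
  \<open>R\<close>-multiple in the ring of integers, and every relation over \<open>K\<close>
  becomes one over \<open>R\<close>.\<close>

lemma basis_F: "module_basis K F z d"
proof -
  have zOF: "z i \<in> OF" if "i < d" for i
    by (subst OF_span, rule CollectI, rule exI[of _ "\<lambda>j. if j = i then 1 else 0"])
      (use that in \<open>auto simp: zero_mem one_mem if_distrib[of "\<lambda>x. x * _"] cong: if_cong\<close>)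
  have le: "\<exists>c. f = (\<Sum>i<d. c i * z i) \<and> (\<forall>i<d. c i \<in> K)" if f: "f \<in> F" for f
  proof -
    obtain D where D: "D \<in> R" "D \<noteq> 0" "D * f \<in> OL" by (rule integral_multiple)
    have "D * f \<in> OF" using D f R_subset_K K_F F.mult_mem by (auto simp: OF_iff)
    then obtain c where c: "D * f = (\<Sum>i<d. c i * z i)" "\<forall>i<d. c i \<in> R"
      by (subst (asm) OF_span) blast
    have "f = inverse D * (D * f)" using D(2) by simp
    also have "\<dots> = (\<Sum>i<d. (inverse D * c i) * z i)" by (simp add: c sum_distrib_left mult.assoc)
    finally show ?thesis
      using c(2) D(1) R_subset_K
      by (intro exI[of _ "\<lambda>i. inverse D * c i"]) (auto intro!: K.mult_mem K_inverse)
  qed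
  have ge: "(\<Sum>i<d. c i * z i) \<in> F" if "\<forall>i<d. c i \<in> K" for c
    by (rule F.sum_mem, rule F.mult_mem) (use that K_F zOF OF_iff in auto)
  have indep: "c i = 0" if c: "\<forall>i<d. c i \<in> K" "(\<Sum>i<d. c i * z i) = 0" and i: "i < d" for c i
  proof -
    obtain D where D: "D \<in> R" "D \<noteq> 0" "\<And>i. i \<in> {..<d} \<Longrightarrow> D * c i \<in> R"
      by (rule common_denominator[of "{..<d}" c]) (use c in auto)
    have "(\<Sum>i<d. (D * c i) * z i) = D * (\<Sum>i<d. c i * z i)" by (simp add: sum_distrib_left mult.assoc)
    then have "D * c i = 0" using c(2) D(3) by (intro OF_indep[of "\<lambda>i. D * c i" i]) (simp_all add: i)
    then show ?thesis using D(2) by simp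
  qed
  have "F = {\<Sum>i<d. c i * z i | c. \<forall>i<d. c i \<in> K}"
  proof (intro equalityI subsetI)
    show "f \<in> {\<Sum>i<d. c i * z i | c. \<forall>i<d. c i \<in> K}" if "f \<in> F" for f
      using le[OF that] by (rule CollectI)
    show "f \<in> F" if "f \<in> {\<Sum>i<d. c i * z i | c. \<forall>i<d. c i \<in> K}" for f
      using that ge by (elim CollectE exE conjE) (simp only:)
  qed
  then show ?thesis unfolding module_basis_def using indep by (intro conjI allI impI) simp_all
qed

lemma module_F: "module (subring_of K) (mult_module F)"
  by (rule K.module_mult_module) (use K_F F.zero_mem F.add_mem F.mult_mem in auto)

lemma module_E: "module (subring_of K) (mult_module E)"
  by (rule K.module_mult_module) (use K_E E.zero_mem E.add_mem E.mult_mem in auto)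

lemma module_OF: "module (subring_of R) (mult_module OF)"
  by (rule module_mult_module) (use R_OF OF.zero_mem OF.add_mem OF.mult_mem in auto)

lemma module_OE: "module (subring_of R) (mult_module OE)"
  by (rule module_mult_module) (use R_OE OE.zero_mem OE.add_mem OE.mult_mem in auto)

lemma A1_iff: "h \<in> A1 \<longleftrightarrow> h \<in> carrier H1 \<and> (\<forall>x\<in>OE. act h x \<in> OE)"
  by (simp add: associated_order_def)

lemma A1_carrier: "h \<in> A1 \<Longrightarrow> h \<in> carrier H1" and A1_act: "h \<in> A1 \<Longrightarrow> x \<in> OE \<Longrightarrow> act h x \<in> OE"
  by (simp_all only: A1_iff)

sublocale H1: module "subring_of K" H1 by (rule module_H1)

lemma module_A1: "module (subring_of R) HA"
proof (rule module_hopf_suborder)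
  show "0 \<in> A1"
    using H1.zero_closed OE.zero_mem unfolding A1_iff by (simp add: hopf_action_zero)
  show "c + e \<in> A1" if "c \<in> A1" "e \<in> A1" for c e
    using H1.a_closed[of c e] that OE.add_mem unfolding A1_iff by (simp add: hopf_action_add)
  show "scale_coeffs k c \<in> A1" if "k \<in> R" "c \<in> A1" for k c
    using H1.smult_closed[of k c] that OE.mult_mem R_OE R_subset_K unfolding A1_iff
    by (auto simp: hopf_action_scale subset_iff)
qed

sublocale EF: free_tensor K F "mult_module E" z d
  by (rule free_tensor.intro[OF module_E module_F basis_F])
sublocale HF: free_tensor K F H1 z d
  by (rule free_tensor.intro[OF module_H1 module_F basis_F])
sublocale OEF: free_tensor R OF "mult_module OE" z d
  by (rule free_tensor.intro[OF module_OE module_OF basis_OF])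
sublocale AO: free_tensor R OF HA z d
  by (rule free_tensor.intro[OF module_A1 module_OF basis_OF])

lemma zF: "i < d \<Longrightarrow> z i \<in> F" by (rule EF.basis_mem)
lemma zOF: "i < d \<Longrightarrow> z i \<in> OF" by (rule OEF.basis_mem)

lemma mult_map_tsum:
  assumes "\<And>i. i < d \<Longrightarrow> a i \<in> E"
  shows "mult_map K E F (EF.tsum z a d) = (\<Sum>i<d. a i * z i)"
  unfolding mult_map_def using EF.lift_tsum[OF balanced_mult, of d a z] assms zF by simp

text \<open>The multiplication map is injective and normal forms in \<open>E \<otimes> F\<close>
  have unique coefficients; so the \<open>z i\<close> are independent over \<open>E\<close>, not
  only over \<open>K\<close>.\<close>

lemma E_indep:
  assumes a: "\<And>i. i < d \<Longrightarrow> a i \<in> E" and b: "\<And>i. i < d \<Longrightarrow> b i \<in> E"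
    and eq: "(\<Sum>i<d. a i * z i) = (\<Sum>i<d. b i * z i)" and i: "i < d"
  shows "a i = b i"
proof -
  have "EF.tsum z a d \<in> carrier (field_tensor K E F)" "EF.tsum z b d \<in> carrier (field_tensor K E F)"
    using EF.tsum_closed[of d a z] EF.tsum_closed[of d b z] a b zF by simp_all
  moreover have "mult_map K E F (EF.tsum z a d) = mult_map K E F (EF.tsum z b d)"
    using mult_map_tsum[of a] mult_map_tsum[of b] a b eq by simp
  ultimately have "EF.tsum z a d = EF.tsum z b d"
    using lin_disjoint unfolding linearly_disjoint_def by (rule_tac inj_onD)
  then show ?thesis using EF.tsum_inj[of a b i] a b i by simp
qed

text \<open>\<open>base_change_action\<close> reads its argument through this inverse; this makes it
  computable on combinations of the \<open>z i\<close>.\<close>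

lemma inv_mult_map:
  assumes a: "\<And>i. i < d \<Longrightarrow> a i \<in> E"
  shows "inv_into (carrier (field_tensor K E F)) (mult_map K E F) (\<Sum>i<d. a i * z i) = EF.tsum z a d"
proof -
  have t: "EF.tsum z a d \<in> carrier (field_tensor K E F)"
    using EF.tsum_closed[of d a z] a zF by simp
  show ?thesis
    using inv_into_f_f[OF lin_disjoint[unfolded linearly_disjoint_def] t] mult_map_tsum[of a, OF a]
    by (simp only:)
qed

text \<open>Every tensor over \<open>R\<close> has a normal form, and multiplication maps these
  tensors onto the ring of integers of the top field.\<close>

lemma OL_eq: "OL = {\<Sum>i<d. a i * z i | a. \<forall>i<d. a i \<in> OE}"
proof -
  have tsum: "mult_map R OE OF (OEF.tsum z a d) = (\<Sum>i<d. a i * z i)" if "\<forall>i<d. a i \<in> OE" for a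
    unfolding mult_map_def using OEF.lift_tsum[OF balanced_mult, of d a z] that zOF by simp
  show ?thesis
  proof (intro equalityI subsetI)
    fix x assume "x \<in> OL"
    then obtain t where t: "t \<in> carrier (field_tensor R OE OF)" "x = mult_map R OE OF t"
      unfolding arith[symmetric] by blast
    obtain a where a: "\<And>i. i < d \<Longrightarrow> a i \<in> carrier (mult_module OE)" "t = OEF.tsum z a d"
      by (rule OEF.tsum_exists[OF t(1)]) blast
    then show "x \<in> {\<Sum>i<d. a i * z i | a. \<forall>i<d. a i \<in> OE}"
      using t(2) tsum[of a] by (intro CollectI exI[of _ a]) simp
  next
    fix x assume "x \<in> {\<Sum>i<d. a i * z i | a. \<forall>i<d. a i \<in> OE}"
    then obtain a where a: "\<forall>i<d. a i \<in> OE" "x = (\<Sum>i<d. a i * z i)" by blast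
    have "a i * z i \<in> OL" if "i < d" for i
      using a(1) zOF[OF that] that by (intro OL.mult_mem) (auto simp: OE_iff OF_iff)
    then show "x \<in> OL" unfolding a(2) by (intro OL.sum_mem) simp
  qed
qed

lemma OL_span:
  assumes "x \<in> OL" obtains a where "\<And>i. i < d \<Longrightarrow> a i \<in> OE" "x = (\<Sum>i<d. a i * z i)"
proof -
  have "x \<in> {\<Sum>i<d. a i * z i | a. \<forall>i<d. a i \<in> OE}" using assms by (subst (asm) OL_eq)
  then show thesis using that by blast
qed

section \<open>The base-changed action in coordinates\<close>

abbreviation "bca \<equiv> base_change_action K E F H1 act"

text \<open>Two lifts are nested. The inner one is evaluated first, on the normal form of the
  argument; its explicit value shows that the outer function is balanced, after which the outer lift
  can be evaluated too.\<close>

lemma base_change_tsum: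
  assumes h: "\<And>i. i < d \<Longrightarrow> h i \<in> carrier H1" and a: "\<And>i. i < d \<Longrightarrow> a i \<in> E"
  shows "bca (HF.tsum z h d) (\<Sum>i<d. a i * z i) = (\<Sum>i<d. \<Sum>j<d. act (h i) (a j) * (z i * z j))"
proof -
  let ?x = "\<Sum>i<d. a i * z i"
  let ?u = "inv_into (carrier (field_tensor K E F)) (mult_map K E F) ?x"
  let ?phi = "\<lambda>w f. tensor_lift (subring_of K) (mult_module E) (mult_module F) (add_monoid top_ring)
      (\<lambda>\<alpha> z. act w \<alpha> * (f * z)) ?u"
  have u: "?u = EF.tsum z a d" by (rule inv_mult_map) (rule a)
  have phi: "?phi w f = (\<Sum>j<d. act w (a j) * (f * z j))" if w: "w \<in> carrier H1" for w f
  proof -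
    have "balanced_map (subring_of K) (mult_module E) (mult_module F) (add_monoid top_ring) (\<lambda>\<alpha> z. act w \<alpha> * (f * z))"
      by (simp add: balanced_map_def act_add_right[OF w] act_scale_right[OF w] distrib_left distrib_right mult_ac
          del: hopf_algebra_simps)
    then have "tensor_lift (subring_of K) (mult_module E) (mult_module F) (add_monoid top_ring)
        (\<lambda>\<alpha> z. act w \<alpha> * (f * z)) (EF.tsum z a d) = (\<Sum>j<d. act w (a j) * (f * z j))"
      by (rule EF.lift_tsum) (use a zF in simp_all)
    then show ?thesis by (simp only: u)
  qed
  have "balanced_map (subring_of K) H1 (mult_module F) (add_monoid top_ring) ?phi"
  proof -
    have "?phi (w \<oplus>\<^bsub>H1\<^esub> w') f = ?phi w f + ?phi w' f" if "w \<in> carrier H1" "w' \<in> carrier H1" for w w' f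
      by (simp only: phi[OF that(1)] phi[OF that(2)] phi[OF H1.a_closed[OF that]])
        (simp add: hopf_action_add distrib_right sum.distrib)
    moreover have "?phi w (f + f') = ?phi w f + ?phi w f'" if "w \<in> carrier H1" for w f f'
      by (simp only: phi[OF that]) (simp add: distrib_right distrib_left sum.distrib)
    moreover have "?phi (k \<odot>\<^bsub>H1\<^esub> w) f = ?phi w (k * f)" if "k \<in> K" "w \<in> carrier H1" for k w f
    proof -
      have "k \<odot>\<^bsub>H1\<^esub> w \<in> carrier H1" using H1.smult_closed[of k w] that by simp
      then show ?thesis
        by (simp only: phi that(2)) (simp add: hopf_action_scale mult_ac)
    qed
    ultimately show ?thesis by (simp add: balanced_map_def del: hopf_algebra_simps)
  qed
  then have "bca (HF.tsum z h d) ?x = (\<Sum>i<d. ?phi (h i) (z i))"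
    unfolding base_change_action_def using HF.lift_tsum[of ?phi d h z] h zF
    by (simp del: hopf_algebra_simps)
  also have "\<dots> = (\<Sum>i<d. \<Sum>j<d. act (h i) (a j) * (z i * z j))"
    by (rule sum.cong) (use phi h in auto)
  finally show ?thesis .
qed

text \<open>Since 1 need not be among the \<open>z i\<close>, \<open>\<alpha>\<close> is written as
  \<open>\<alpha>\<close> times the expansion of 1. \<open>K\<close>-linearity of each
  \<open>act (h i)\<close> pulls the coefficients out, and the inner sum collapses back to
  1.\<close>

lemma base_change_tsum_E:
  assumes h: "\<And>i. i < d \<Longrightarrow> h i \<in> carrier H1" and \<alpha>: "\<alpha> \<in> E"
  shows "bca (HF.tsum z h d) \<alpha> = (\<Sum>i<d. act (h i) \<alpha> * z i)"
proof -
  obtain c where c: "\<forall>i<d. c i \<in> K" "1 = (\<Sum>i<d. c i * z i)" by (rule EF.basis_spanE[OF F.one_mem])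
  have "\<alpha> = \<alpha> * (\<Sum>i<d. c i * z i)" by (simp flip: c(2))
  also have "\<dots> = (\<Sum>i<d. (c i * \<alpha>) * z i)" by (simp add: sum_distrib_left mult_ac)
  finally have "bca (HF.tsum z h d) \<alpha> = bca (HF.tsum z h d) (\<Sum>i<d. (c i * \<alpha>) * z i)" by (rule arg_cong)
  also have "\<dots> = (\<Sum>i<d. \<Sum>j<d. act (h i) (c j * \<alpha>) * (z i * z j))"
    by (rule base_change_tsum[OF h]) (use c(1) K_E \<alpha> E.mult_mem in auto)
  also have "\<dots> = (\<Sum>i<d. act (h i) \<alpha> * z i * (\<Sum>j<d. c j * z j))"
  proof (rule sum.cong)
    fix i assume "i \<in> {..<d}"
    then have "act (h i) (c j * \<alpha>) = c j * act (h i) \<alpha>" if "j < d" for j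
      using act_scale_right[OF h] c(1) that by simp
    then show "(\<Sum>j<d. act (h i) (c j * \<alpha>) * (z i * z j)) = act (h i) \<alpha> * z i * (\<Sum>j<d. c j * z j)"
      by (simp add: sum_distrib_left mult_ac)
  qed simp
  finally show ?thesis by (simp flip: c(2))
qed

abbreviation "A1F \<equiv> associated_order (carrier H1F) bca OL"

lemma tsum_A1F:
  assumes h: "\<And>i. i < d \<Longrightarrow> h i \<in> A1" shows "HF.tsum z h d \<in> A1F"
proof -
  have hH: "h i \<in> carrier H1" if "i < d" for i by (rule A1_carrier[OF h[OF that]])
  have "bca (HF.tsum z h d) x \<in> OL" if x: "x \<in> OL" for x
  proof -
    obtain a where a: "\<And>i. i < d \<Longrightarrow> a i \<in> OE" "x = (\<Sum>i<d. a i * z i)" by (rule OL_span[OF x]) blast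
    have aE: "a i \<in> E" if "i < d" for i using a(1)[OF that] by (simp add: OE_iff)
    have "act (h i) (a j) * (z i * z j) \<in> OL" if ij: "i < d" "j < d" for i j
    proof -
      have "act (h i) (a j) \<in> OL" using A1_act[OF h[OF ij(1)] a(1)[OF ij(2)]] by (simp only: OE_iff)
      then show ?thesis using zOF ij by (simp add: OL.mult_mem OF_iff)
    qed
    then have "(\<Sum>i<d. \<Sum>j<d. act (h i) (a j) * (z i * z j)) \<in> OL" by (intro OL.sum_mem) simp
    moreover have "bca (HF.tsum z h d) x = (\<Sum>i<d. \<Sum>j<d. act (h i) (a j) * (z i * z j))"
      unfolding a(2) by (rule base_change_tsum[OF hH aE])
    ultimately show ?thesis by (simp only:)
  qed
  moreover have "HF.tsum z h d \<in> carrier H1F"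
    by (rule HF.tsum_closed) (use hH zF in \<open>simp_all del: hopf_algebra_simps\<close>)
  ultimately show ?thesis by (simp add: associated_order_def)
qed

text \<open>It suffices to test \<open>t\<close> on integers of \<open>E\<close>. There its value
  has coefficients \<open>act (h i) \<alpha>\<close>, which lie in \<open>E\<close> by
  \<open>act_E\<close>; by independence over \<open>E\<close> they agree with the integral
  coefficients of an element of \<open>OL\<close>.\<close>

lemma A1F_tsum:
  assumes t: "t \<in> A1F" obtains h where "\<And>i. i < d \<Longrightarrow> h i \<in> A1" "t = HF.tsum z h d"
proof -
  have tc: "t \<in> carrier H1F" and tOL: "\<And>x. x \<in> OL \<Longrightarrow> bca t x \<in> OL"
    using t by (auto simp: associated_order_def)
  obtain h where h: "\<And>i. i < d \<Longrightarrow> h i \<in> carrier H1" "t = HF.tsum z h d" by (rule HF.tsum_exists[OF tc]) blast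
  have "h i \<in> A1" if i: "i < d" for i
    unfolding A1_iff
  proof (intro conjI ballI)
    show "h i \<in> carrier H1" by (rule h(1)[OF i])
    fix \<alpha> assume \<alpha>: "\<alpha> \<in> OE"
    then have \<alpha>': "\<alpha> \<in> OL" "\<alpha> \<in> E" by (simp_all add: OE_iff)
    have "bca t \<alpha> = (\<Sum>i<d. act (h i) \<alpha> * z i)"
      unfolding h(2) by (rule base_change_tsum_E[OF h(1) \<alpha>'(2)])
    then have "(\<Sum>i<d. act (h i) \<alpha> * z i) \<in> OL" using tOL[OF \<alpha>'(1)] by (simp only:)
    then obtain e where e: "\<And>i. i < d \<Longrightarrow> e i \<in> OE" "(\<Sum>i<d. act (h i) \<alpha> * z i) = (\<Sum>i<d. e i * z i)"
      by (rule OL_span) blast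
    have "act (h i) \<alpha> = e i"
    proof (rule E_indep[OF _ _ e(2) i])
      show "act (h j) \<alpha> \<in> E" if "j < d" for j by (rule act_E[OF h(1)[OF that] \<alpha>'(2)])
      show "e j \<in> E" if "j < d" for j using e(1)[OF that] by (simp add: OE_iff)
    qed
    then show "act (h i) \<alpha> \<in> OE" using e(1)[OF i] by simp
  qed
  then show thesis using h(2) by (rule that)
qed

section \<open>The canonical map from the integral tensor product\<close>

abbreviation "can \<equiv> tensor_lift (subring_of R) HA (mult_module OF) H1F (pure_tensor (subring_of K) H1 (mult_module F))"

text \<open>The canonical map keeps coefficients and only reads the normal form over
  \<open>K\<close> instead of \<open>R\<close>. The induction stays below \<open>d\<close>, where
  the coefficients are known to lie in \<open>A1\<close>.\<close>

lemma can_tsum: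
  assumes h: "\<And>i. i < d \<Longrightarrow> h i \<in> A1" shows "can (AO.tsum z h d) = HF.tsum z h d"
proof -
  have HA: "carrier HA = A1" "x \<oplus>\<^bsub>HA\<^esub> y = x \<oplus>\<^bsub>H1\<^esub> y" "r \<odot>\<^bsub>HA\<^esub> x = r \<odot>\<^bsub>H1\<^esub> x" for x y r
    by simp_all
  have A1H: "m \<in> carrier H1" if "m \<in> A1" for m by (rule A1_carrier[OF that])
  have FF: "n \<in> carrier (mult_module F)" if "n \<in> OF" for n using that by (simp add: OF_iff)
  have KK: "r \<in> carrier (subring_of K)" if "r \<in> R" for r using that R_subset_K by auto
  have bal: "balanced_map (subring_of R) HA (mult_module OF) H1F (pure_tensor (subring_of K) H1 (mult_module F))"
    unfolding balanced_map_def HA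
  proof (intro conjI ballI)
    show "pure_tensor (subring_of K) H1 (mult_module F) m n \<in> carrier H1F"
      if "m \<in> A1" "n \<in> carrier (mult_module OF)" for m n
      using HF.pure_closed[OF A1H FF] that by simp
    show "pure_tensor (subring_of K) H1 (mult_module F) (m \<oplus>\<^bsub>H1\<^esub> m') n =
        pure_tensor (subring_of K) H1 (mult_module F) m n \<otimes>\<^bsub>H1F\<^esub> pure_tensor (subring_of K) H1 (mult_module F) m' n"
      if "m \<in> A1" "m' \<in> A1" "n \<in> carrier (mult_module OF)" for m m' n
      using HF.pure_add_left[OF A1H A1H FF] that by (simp only: mult_module_simps)
    show "pure_tensor (subring_of K) H1 (mult_module F) m (n \<oplus>\<^bsub>mult_module OF\<^esub> n') =
        pure_tensor (subring_of K) H1 (mult_module F) m n \<otimes>\<^bsub>H1F\<^esub> pure_tensor (subring_of K) H1 (mult_module F) m n'"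
      if "m \<in> A1" "n \<in> carrier (mult_module OF)" "n' \<in> carrier (mult_module OF)" for m n n'
      using HF.pure_add_right[OF A1H FF FF] that by (simp only: mult_module_simps)
    show "pure_tensor (subring_of K) H1 (mult_module F) (r \<odot>\<^bsub>H1\<^esub> m) n =
        pure_tensor (subring_of K) H1 (mult_module F) m (r \<odot>\<^bsub>mult_module OF\<^esub> n)"
      if "r \<in> carrier (subring_of R)" "m \<in> A1" "n \<in> carrier (mult_module OF)" for r m n
    proof -
      have "r \<in> R" using that(1) by simp
      then show ?thesis using HF.pure_balanced[OF KK A1H FF] that(2,3) by (simp only: mult_module_simps)
    qed
  qed
  note hom = AO.lift_hom[OF HF.T.comm_group_axioms bal]
  have "can (AO.tsum z h k) = HF.tsum z h k" if "k \<le> d" for k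
    using that
  proof (induction k)
    case 0
    show ?case unfolding AO.tsum.simps HF.tsum.simps
      by (rule hom_one[OF hom AO.T.group_axioms HF.T.group_axioms])
  next
    case (Suc k)
    have 1: "AO.tsum z h k \<in> carrier (tensor_product (subring_of R) HA (mult_module OF))"
      by (rule AO.tsum_closed) (use Suc.prems h zOF in auto)
    have 2: "pure_tensor (subring_of R) HA (mult_module OF) (h k) (z k)
        \<in> carrier (tensor_product (subring_of R) HA (mult_module OF))"
      by (rule AO.pure_closed) (use Suc.prems h zOF in auto)
    have 3: "can (pure_tensor (subring_of R) HA (mult_module OF) (h k) (z k)) =
        pure_tensor (subring_of K) H1 (mult_module F) (h k) (z k)"
      by (rule AO.lift_pure[OF HF.T.comm_group_axioms bal]) (use Suc.prems h zOF in auto)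
    have 4: "can (AO.tsum z h k) = HF.tsum z h k" using Suc by simp
    show ?case unfolding AO.tsum.simps HF.tsum.simps by (simp only: hom_mult[OF hom 1 2] 3 4)
  qed
  then show ?thesis by simp
qed

lemma AO_tsum_exists:
  assumes "t \<in> carrier (tensor_product (subring_of R) HA (mult_module OF))"
  obtains h where "\<And>i. i < d \<Longrightarrow> h i \<in> A1" "t = AO.tsum z h d"
  using AO.tsum_exists[OF assms] by auto

lemma tsum_HF_inj:
  assumes "\<And>i. i < d \<Longrightarrow> h i \<in> A1" "\<And>i. i < d \<Longrightarrow> h' i \<in> A1" "HF.tsum z h d = HF.tsum z h' d" "i < d"
  shows "h i = h' i"
  by (rule HF.tsum_inj[OF _ _ assms(3,4)]) (rule A1_carrier, erule assms(1) assms(2))+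

text \<open>Equal images have equal coefficients over \<open>K\<close>, and these determine the
  tensor over \<open>R\<close>. Injectivity is what entitles that tensor product to be regarded
  inside \<open>H1F\<close>.\<close>

lemma can_inj: "inj_on can (carrier (tensor_product (subring_of R) HA (mult_module OF)))"
proof (rule inj_onI)
  fix s t
  assume st: "s \<in> carrier (tensor_product (subring_of R) HA (mult_module OF))"
    "t \<in> carrier (tensor_product (subring_of R) HA (mult_module OF))" and eq: "can s = can t"
  obtain h where h: "\<And>i. i < d \<Longrightarrow> h i \<in> A1" "s = AO.tsum z h d" by (rule AO_tsum_exists[OF st(1)]) blast
  obtain h' where h': "\<And>i. i < d \<Longrightarrow> h' i \<in> A1" "t = AO.tsum z h' d" by (rule AO_tsum_exists[OF st(2)]) blast
  have "can s = HF.tsum z h d" unfolding h(2) by (rule can_tsum[OF h(1)])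
  moreover have "can t = HF.tsum z h' d" unfolding h'(2) by (rule can_tsum[OF h'(1)])
  ultimately have eq': "HF.tsum z h d = HF.tsum z h' d" using eq by (simp only:)
  have "h i = h' i" if "i < d" for i by (rule tsum_HF_inj[OF h(1) h'(1) eq' that])
  then show "s = t" unfolding h(2) h'(2) by (rule AO.tsum_cong)
qed

text \<open>Both sides consist of the normal forms over \<open>K\<close> with coefficients in
  \<open>A1\<close>.\<close>

lemma can_image: "A1F = can ` carrier (tensor_product (subring_of R) HA (mult_module OF))"
proof (intro equalityI subsetI)
  fix t assume "t \<in> A1F"
  then obtain h where h: "\<And>i. i < d \<Longrightarrow> h i \<in> A1" "t = HF.tsum z h d" by (rule A1F_tsum) blast
  have "AO.tsum z h d \<in> carrier (tensor_product (subring_of R) HA (mult_module OF))"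
    by (rule AO.tsum_closed) (use h zOF in auto)
  moreover have "t = can (AO.tsum z h d)" unfolding h(2) by (rule can_tsum[OF h(1), symmetric])
  ultimately show "t \<in> can ` carrier (tensor_product (subring_of R) HA (mult_module OF))"
    by (rule_tac image_eqI)
next
  fix t assume "t \<in> can ` carrier (tensor_product (subring_of R) HA (mult_module OF))"
  then obtain s where s: "s \<in> carrier (tensor_product (subring_of R) HA (mult_module OF))" "t = can s" by blast
  obtain h where h: "\<And>i. i < d \<Longrightarrow> h i \<in> A1" "s = AO.tsum z h d" by (rule AO_tsum_exists[OF s(1)]) blast
  have "can s = HF.tsum z h d" unfolding h(2) by (rule can_tsum[OF h(1)])
  moreover have "HF.tsum z h d \<in> A1F" by (rule tsum_A1F[OF h(1)])
  ultimately show "t \<in> A1F" using s(2) by (simp only:)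
qed

text \<open>In coordinates, \<open>t \<mapsto> bca t \<beta>\<close> applies the bijection
  \<open>a \<mapsto> act a \<beta>\<close> to each coefficient, and coefficients are unique on both
  sides.\<close>

lemma free_base_change:
  assumes "free_over_order A1 act OE" shows "free_over_order A1F bca OL"
proof -
  obtain \<beta> where \<beta>: "\<beta> \<in> OE" "bij_betw (\<lambda>a. act a \<beta>) A1 OE"
    using assms by (auto simp: free_over_order_def)
  have inj: "inj_on (\<lambda>a. act a \<beta>) A1" and surj: "(\<lambda>a. act a \<beta>) ` A1 = OE"
    using \<beta>(2) by (simp_all add: bij_betw_def)
  have \<beta>': "\<beta> \<in> OL" "\<beta> \<in> E" using \<beta>(1) by (simp_all add: OE_iff)
  have val: "bca (HF.tsum z h d) \<beta> = (\<Sum>i<d. act (h i) \<beta> * z i)" if "\<And>i. i < d \<Longrightarrow> h i \<in> A1" for h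
    by (rule base_change_tsum_E[OF _ \<beta>'(2)], rule A1_carrier, erule that)
  have actE: "act h \<beta> \<in> E" if "h \<in> A1" for h
    by (rule act_E[OF A1_carrier[OF that] \<beta>'(2)])
  have "inj_on (\<lambda>t. bca t \<beta>) A1F"
  proof (rule inj_onI)
    fix s t assume st: "s \<in> A1F" "t \<in> A1F" "bca s \<beta> = bca t \<beta>"
    obtain h where h: "\<And>i. i < d \<Longrightarrow> h i \<in> A1" "s = HF.tsum z h d" by (rule A1F_tsum[OF st(1)]) blast
    obtain h' where h': "\<And>i. i < d \<Longrightarrow> h' i \<in> A1" "t = HF.tsum z h' d" by (rule A1F_tsum[OF st(2)]) blast
    have eq: "(\<Sum>i<d. act (h i) \<beta> * z i) = (\<Sum>i<d. act (h' i) \<beta> * z i)"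
    proof -
      have "bca s \<beta> = (\<Sum>i<d. act (h i) \<beta> * z i)" unfolding h(2) by (rule val[OF h(1)])
      moreover have "bca t \<beta> = (\<Sum>i<d. act (h' i) \<beta> * z i)" unfolding h'(2) by (rule val[OF h'(1)])
      ultimately show ?thesis using st(3) by simp
    qed
    have "h i = h' i" if i: "i < d" for i
    proof -
      have "act (h i) \<beta> = act (h' i) \<beta>"
        by (rule E_indep[OF _ _ eq i]) (rule actE, erule h(1) h'(1))+
      then show ?thesis using inj_onD[OF inj _ h(1)[OF i] h'(1)[OF i]] by simp
    qed
    then show "s = t" unfolding h(2) h'(2) by (rule HF.tsum_cong)
  qed
  moreover have "(\<lambda>t. bca t \<beta>) ` A1F = OL"
  proof (intro equalityI subsetI)
    fix x assume "x \<in> (\<lambda>t. bca t \<beta>) ` A1F"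
    then obtain t where "t \<in> A1F" "x = bca t \<beta>" by blast
    then show "x \<in> OL" using \<beta>'(1) by (simp add: associated_order_def)
  next
    fix x assume "x \<in> OL"
    then obtain e where e: "\<And>i. i < d \<Longrightarrow> e i \<in> OE" "x = (\<Sum>i<d. e i * z i)" by (rule OL_span) blast
    define h where "h i = inv_into A1 (\<lambda>a. act a \<beta>) (e i)" for i
    have e_image: "e i \<in> (\<lambda>a. act a \<beta>) ` A1" if "i < d" for i
      by (subst surj) (rule e(1)[OF that])
    have h: "h i \<in> A1" "act (h i) \<beta> = e i" if "i < d" for i
      unfolding h_def using inv_into_into[OF e_image[OF that]] f_inv_into_f[OF e_image[OF that]] .
    have "bca (HF.tsum z h d) \<beta> = (\<Sum>i<d. act (h i) \<beta> * z i)" by (rule val[OF h(1)])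
    also have "\<dots> = x" unfolding e(2) by (intro sum.cong) (simp_all add: h(2))
    finally have "x = bca (HF.tsum z h d) \<beta>" by (rule sym)
    moreover have "HF.tsum z h d \<in> A1F" by (rule tsum_A1F[OF h(1)])
    ultimately show "x \<in> (\<lambda>t. bca t \<beta>) ` A1F" by (rule image_eqI)
  qed
  ultimately show ?thesis unfolding free_over_order_def bij_betw_def using \<beta>'(1) by blast
qed

end

theorem theorem1p6:
  fixes OK K E F OE OF OL :: "'a::field set"
    and J G' :: "('a \<Rightarrow> 'a) set"
    and N1 N2 N :: "(('a \<Rightarrow> 'a) \<Rightarrow> ('a \<Rightarrow> 'a)) set"
    and H1 Hbar H :: "('a, (('a \<Rightarrow> 'a) \<Rightarrow> ('a \<Rightarrow> 'a)) \<Rightarrow>\<^sub>0 'a) module"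
  assumes "principal_domain (subring_of OK)"
    and "K = quotient_field OK"
    and "finite_galois K"
    and "J \<lhd> galois_group K"
    and "subgroup G' (galois_group K)"
    and "J \<inter> G' = {\<one>\<^bsub>galois_group K\<^esub>}"
    and "J <#>\<^bsub>galois_group K\<^esub> G' = carrier (galois_group K)"
    and "E = fixed_field G'"
    and "F = fixed_field J"
    and "OL = integral_closure OK UNIV"
    and "OE = integral_closure OK E"
    and "OF = integral_closure OK F"
    and "induced_structure K J G' N1 N2 N"
    and "H1 = hopf_algebra UNIV (carrier (galois_group K)) (BijGroup J) (lambda_c J G') N1"
    and "Hbar = hopf_algebra F G' (BijGroup G') (left_regular G') N2"
    and "H = hopf_algebra UNIV (carrier (galois_group K)) (BijGroup (carrier (galois_group K)))
               (left_regular (carrier (galois_group K))) N"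
    and "arithmetically_disjoint OK K E F"
  shows
    "let H1F = tensor_product (subring_of K) H1 (mult_module F);
         A1 = associated_order (carrier H1) (hopf_action J) OE;
         act = base_change_action K E F H1 (hopf_action J);
         A1F = associated_order (carrier H1F) act OL;
         A1_OF = tensor_product (subring_of OK) (H1\<lparr>carrier := A1\<rparr>) (mult_module OF);
         can = tensor_lift (subring_of OK) (H1\<lparr>carrier := A1\<rparr>) (mult_module OF) H1F
                 (pure_tensor (subring_of K) H1 (mult_module F))
     in (inj_on can (carrier A1_OF) \<and> A1F = can ` carrier A1_OF) \<and>
        (free_over_order A1 (hopf_action J) OE \<longrightarrow> free_over_order A1F act OL)"
proof -
  have group: "Group.group (galois_group K)" using assms(4) by (simp add: normal_def)
  have N1: "subgroup N1 (BijGroup J)"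
    and lambda: "lambda_c J G' ` carrier (galois_group K) \<subseteq> normalizer (BijGroup J) N1"
    using assms(13) by (simp_all add: induced_structure_def regular_perm_group_def)
  interpret galois_ext K
    by (rule galois_ext.intro[OF assms(3) group])
  interpret galois_pid K OK
    by (intro galois_pid.intro galois_ext_axioms pid_subring.intro assms(1) galois_pid_axioms.intro assms(2))
  interpret galois_split K J G'
    using assms(4-6) by (intro galois_split.intro galois_ext_axioms galois_split_axioms.intro) simp_all
  \<comment> \<open>The normalizer lies inside the permutation group.\<close>
  have "lambda_c J G' \<tau> \<in> carrier (BijGroup J)" if "\<tau> \<in> G'" for \<tau>
    using lambda subgroup_memD(2)[OF assms(5) that] by (auto simp: normalizer_def stabilizer_def)
  then interpret hopf_setup K J G' N1
    by (intro hopf_setup.intro galois_split_axioms hopf_setup_axioms.intro N1)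
  have "OK \<subseteq> fixed_field J"
    using R_subset_K K_subset_fixed_field[OF subgroup.subset[OF subgroup_J]] by blast
  \<comment> \<open>The basis is fixed before the last interpretation because it is a parameter of
    that locale.\<close>
  then obtain z d where z: "module_basis OK (integral_closure OK (fixed_field J)) z d"
    using integral_closure_free[OF F.field_subring_axioms] by blast
  interpret arithmetic_setup K J G' N1 OK z d
  proof (intro arithmetic_setup.intro hopf_setup_axioms galois_pid_axioms arithmetic_setup_axioms.intro z)
    show "linearly_disjoint K (fixed_field G') (fixed_field J)"
      using assms(17) by (simp add: arithmetically_disjoint_def assms(8,9))
    show "mult_map OK (integral_closure OK (fixed_field G')) (integral_closure OK (fixed_field J)) `
        carrier (field_tensor OK (integral_closure OK (fixed_field G')) (integral_closure OK (fixed_field J)))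
        = integral_closure OK UNIV"
      using assms(17) unfolding arithmetically_disjoint_def bij_betw_def assms(8,9) generate_field_eq_UNIV
      by blast
  qed
  show ?thesis
    unfolding Let_def assms(8-12,14) using can_inj can_image free_base_change by blast
qed

end
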